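(* Let $N \cong \mathbb{Z}^n$ be a lattice, let $\Sigma$ be a complete fan in $N_{\mathbb{R}} = N \otimes_{\mathbb{Z}} \mathbb{R}$, let $\Sigma(1)$ be the set of primitive generators in $N$ of the 1-dimensional cones of $\Sigma$, and let $X = X(\Sigma)$ be the corresponding toric variety. If $\Sigma(1)$ is not unimodular, then $X$ is not diagonally split at $q = 2$.
   Context: Unimodular: $\Sigma(1)$ is unimodular if every maximal linearly independent subset of $\Sigma(1)$ generates the lattice $N$. Diagonal splittings: let $X$ be a toric variety (over a field) given by a complete fan $\Sigma$. For an integer $q\ge 2$, multiplication by $q$ on $N_{\mathbb{R}}$ preserves $\Sigma$ and induces a morphism $F\colon X\to X$. A splitting of $X$ at $q$ is an $\mathcal{O}_X$-module map $\pi\colon F_*\mathcal{O}_X\to\mathcal{O}_X$ whose composition with the natural map $\mathcal{O}_X\to F_*\mathcal{O}_X$ is the identity. It is compatible with a subvariety $Z\subset X$ with ideal sheaf $I_Z$ if $\pi(F_*I_Z)\subset I_Z$. The toric variety $X$ is diagonally split at $q$ if there is a splitting at $q$ of the toric variety $X\times X$ compatible with the diagonal $\Delta\subset X\times X$. Recalled known characterization (from earlier work of Payne): with $M=\operatorname{Hom}(N,\mathbb{Z})$ and $M_{\mathbb{R}}=M\otimes_{\mathbb{Z}}\mathbb{R}$, $X$ is diagonally split at $q\ge 2$ if and only if the open polytope $\mathbb{F}_\Sigma=\{u\in M_{\mathbb{R}} : |\langle u,v\rangle|<1 \text{ for all } v\in\Sigma(1)\}$ contains a representative of every class in $\frac{1}{q}M/M$.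 *)

theory Defs
  imports
    "HOL-Analysis.Analysis"
    "HOL-Library.Poly_Mapping"
    "HOL-Computational_Algebra.Fraction_Field"
begin

section \<open>Lattices and fans\<close>

definition int_span :: "'a::real_vector set \<Rightarrow> 'a set" where
  "int_span S = {\<Sum>v\<in>T. of_int (c v) *\<^sub>R v | T (c :: 'a \<Rightarrow> int). finite T \<and> T \<subseteq> S}"

text \<open>
  A lattice \<open>N\<close> of rank \<open>n\<close> is realised inside \<open>N\<^sub>\<real> = N \<otimes> \<real>\<close>, a Euclidean space of dimension \<open>n\<close>,
  as the integer span of an arbitrary vector space basis.
\<close>

definition is_lattice :: "'a::euclidean_space set \<Rightarrow> bool" where
  "is_lattice N \<longleftrightarrow> (\<exists>B. independent B \<and> span B = UNIV \<and> N = int_span B)"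

text \<open>
  The inner product identifies \<open>M\<^sub>\<real>\<close> with \<open>N\<^sub>\<real>\<close>; \<open>M = Hom(N, \<int>)\<close> becomes the following set.
\<close>

definition dual_lattice :: "'a::euclidean_space set \<Rightarrow> 'a set" where
  "dual_lattice N = {u. \<forall>v\<in>N. u \<bullet> v \<in> \<int>}"

definition dual_cone :: "'a::euclidean_space set \<Rightarrow> 'a set" where
  "dual_cone \<sigma> = {u. \<forall>v\<in>\<sigma>. u \<bullet> v \<ge> 0}"

definition rational_cone :: "'a::euclidean_space set \<Rightarrow> 'a set \<Rightarrow> bool" where
  "rational_cone N \<sigma> \<longleftrightarrow>
     (\<exists>S. finite S \<and> S \<subseteq> N \<and> \<sigma> = convex_cone hull S) \<and> \<sigma> \<inter> uminus ` \<sigma> = {0}"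

definition cone_face :: "'a::euclidean_space set \<Rightarrow> 'a set \<Rightarrow> bool" where
  "cone_face \<tau> \<sigma> \<longleftrightarrow> (\<exists>u\<in>dual_cone \<sigma>. \<tau> = \<sigma> \<inter> {v. u \<bullet> v = 0})"

definition fan :: "'a::euclidean_space set \<Rightarrow> 'a set set \<Rightarrow> bool" where
  "fan N \<Sigma> \<longleftrightarrow> finite \<Sigma> \<and> \<Sigma> \<noteq> {} \<and> (\<forall>\<sigma>\<in>\<Sigma>. rational_cone N \<sigma>) \<and>
     (\<forall>\<sigma>\<in>\<Sigma>. \<forall>\<tau>. cone_face \<tau> \<sigma> \<longrightarrow> \<tau> \<in> \<Sigma>) \<and>
     (\<forall>\<sigma>\<in>\<Sigma>. \<forall>\<tau>\<in>\<Sigma>. cone_face (\<sigma> \<inter> \<tau>) \<sigma> \<and> cone_face (\<sigma> \<inter> \<tau>) \<tau>)"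

definition complete_fan :: "'a::euclidean_space set \<Rightarrow> 'a set set \<Rightarrow> bool" where
  "complete_fan N \<Sigma> \<longleftrightarrow> fan N \<Sigma> \<and> \<Union>\<Sigma> = UNIV"

definition primitive_vector :: "'a::euclidean_space set \<Rightarrow> 'a \<Rightarrow> bool" where
  "primitive_vector N v \<longleftrightarrow>
     v \<in> N \<and> v \<noteq> 0 \<and> (\<forall>w\<in>N. \<forall>m::nat. v = real m *\<^sub>R w \<longrightarrow> m = 1)"

text \<open>The set \<open>\<Sigma>(1)\<close>.\<close>

definition ray_generators :: "'a::euclidean_space set \<Rightarrow> 'a set set \<Rightarrow> 'a set" where
  "ray_generators N \<Sigma> = {v. primitive_vector N v \<and> {t *\<^sub>R v | t. t \<ge> 0} \<in> \<Sigma>}"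

definition unimodular :: "'a::euclidean_space set \<Rightarrow> 'a set \<Rightarrow> bool" where
  "unimodular N R \<longleftrightarrow>
     (\<forall>B. B \<subseteq> R \<and> independent B \<and> (\<forall>C. B \<subseteq> C \<and> C \<subseteq> R \<and> independent C \<longrightarrow> C = B)
        \<longrightarrow> int_span B = N)"

text \<open>For a fan in \<open>N\<^sub>\<real>\<close>, this is the fan of \<open>X \<times> X\<close> with respect to the lattice \<open>N \<times> N\<close>.\<close>

definition product_fan :: "'a set set \<Rightarrow> ('a \<times> 'a) set set" where
  "product_fan \<Sigma> = {\<sigma> \<times> \<tau> | \<sigma> \<tau>. \<sigma> \<in> \<Sigma> \<and> \<tau> \<in> \<Sigma>}"


section \<open>Group rings\<close>

text \<open>
  The group ring \<open>k[M\<^sub>\<real>]\<close>, an integral domain because \<open>M\<^sub>\<real>\<close> is torsion-free. It only serves as an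
  ambient ring: all coordinate rings below are subrings of \<open>k[M] \<subseteq> k[M\<^sub>\<real>]\<close>. A new type is needed
  because the existing integral domain instance of \<^type>\<open>poly_mapping\<close> asks for a linear order on
  the exponents.
\<close>

typedef (overloaded) ('a, 'k) group_ring = "UNIV :: ('a::euclidean_space \<Rightarrow>\<^sub>0 'k::idom) set"
  by simp

setup_lifting type_definition_group_ring

instantiation group_ring :: (euclidean_space, idom) comm_ring_1
begin

lift_definition zero_group_ring :: "('a, 'b) group_ring" is 0 .
lift_definition one_group_ring :: "('a, 'b) group_ring" is 1 .
lift_definition plus_group_ring ::
  "('a, 'b) group_ring \<Rightarrow> ('a, 'b) group_ring \<Rightarrow> ('a, 'b) group_ring" is "(+)" .
lift_definition minus_group_ring ::
  "('a, 'b) group_ring \<Rightarrow> ('a, 'b) group_ring \<Rightarrow> ('a, 'b) group_ring" is "(-)" .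
lift_definition uminus_group_ring :: "('a, 'b) group_ring \<Rightarrow> ('a, 'b) group_ring" is uminus .
lift_definition times_group_ring ::
  "('a, 'b) group_ring \<Rightarrow> ('a, 'b) group_ring \<Rightarrow> ('a, 'b) group_ring" is "(*)" .

instance
  by standard (transfer; simp add: algebra_simps)+

end

definition pm_push :: "('a \<Rightarrow> 'b) \<Rightarrow> ('a \<Rightarrow>\<^sub>0 'k::comm_semiring_1) \<Rightarrow> ('b \<Rightarrow>\<^sub>0 'k)" where
  "pm_push h f =
     (\<Sum>u\<in>Poly_Mapping.keys f. Poly_Mapping.single (h u) (Poly_Mapping.lookup f u))"

lemma pm_push_superset:
  assumes "finite S" "Poly_Mapping.keys f \<subseteq> S"
  shows "pm_push h f = (\<Sum>u\<in>S. Poly_Mapping.single (h u) (Poly_Mapping.lookup f u))"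
  unfolding pm_push_def
  by (rule sum.mono_neutral_left) (use assms in \<open>auto simp: in_keys_iff\<close>)

lemma pm_push_zero [simp]: "pm_push h 0 = 0"
  by (simp add: pm_push_def)

lemma pm_push_single [simp]: "pm_push h (Poly_Mapping.single u c) = Poly_Mapping.single (h u) c"
  by (subst pm_push_superset[of "{u}"]) auto

lemma pm_push_add: "pm_push h (f + g) = pm_push h f + pm_push h g"
proof -
  let ?S = "Poly_Mapping.keys f \<union> Poly_Mapping.keys g"
  have "Poly_Mapping.keys (f + g) \<subseteq> ?S"
    by (rule Poly_Mapping.keys_add)
  then show ?thesis
    by (simp add: pm_push_superset[of ?S] lookup_add single_add sum.distrib)
qed

lemma pm_push_sum: "pm_push h (\<Sum>i\<in>I. g i) = (\<Sum>i\<in>I. pm_push h (g i))"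
  by (induction I rule: infinite_finite_induct) (auto simp: pm_push_add)

lemma pm_expand: "f = (\<Sum>u\<in>Poly_Mapping.keys f. Poly_Mapping.single u (Poly_Mapping.lookup f u))"
proof (rule poly_mapping_eqI)
  fix v
  show "Poly_Mapping.lookup f v = Poly_Mapping.lookup
    (\<Sum>u\<in>Poly_Mapping.keys f. Poly_Mapping.single u (Poly_Mapping.lookup f u)) v"
    by (cases "v \<in> Poly_Mapping.keys f")
       (auto simp: lookup_sum lookup_single when_def in_keys_iff)
qed

lemma pm_push_mult:
  assumes h: "\<And>u v. h (u + v) = h u + h v"
  shows "pm_push h (f * g) = pm_push h f * pm_push h g"
proof -
  have "f * g = (\<Sum>u\<in>Poly_Mapping.keys f. \<Sum>v\<in>Poly_Mapping.keys g.
      Poly_Mapping.single (u + v) (Poly_Mapping.lookup f u * Poly_Mapping.lookup g v))"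
    by (subst (1) pm_expand[of f], subst (1) pm_expand[of g])
       (simp only: sum_product mult_single)
  then have "pm_push h (f * g) = (\<Sum>u\<in>Poly_Mapping.keys f. \<Sum>v\<in>Poly_Mapping.keys g.
      Poly_Mapping.single (h u + h v) (Poly_Mapping.lookup f u * Poly_Mapping.lookup g v))"
    by (simp add: pm_push_sum h)
  also have "\<dots> = pm_push h f * pm_push h g"
    by (simp only: pm_push_def sum_product mult_single)
  finally show ?thesis .
qed

lemma lookup_pm_push_inj:
  assumes "inj_on h (Poly_Mapping.keys f)" "u \<in> Poly_Mapping.keys f"
  shows "Poly_Mapping.lookup (pm_push h f) (h u) = Poly_Mapping.lookup f u"
proof -
  have "Poly_Mapping.lookup (pm_push h f) (h u) =
      (\<Sum>v\<in>Poly_Mapping.keys f. if v = u then Poly_Mapping.lookup f v else 0)"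
    unfolding pm_push_def lookup_sum
    by (rule sum.cong) (use assms in \<open>auto simp: lookup_single when_def inj_on_def\<close>)
  then show ?thesis
    using assms by simp
qed

lemma pm_push_eq_0_iff:
  assumes "inj_on h (Poly_Mapping.keys f)"
  shows "pm_push h f = 0 \<longleftrightarrow> f = 0"
proof
  assume 0: "pm_push h f = 0"
  show "f = 0"
  proof (rule ccontr)
    assume "f \<noteq> 0"
    then obtain u where "u \<in> Poly_Mapping.keys f"
      by (metis all_not_in_conv keys_eq_empty)
    with lookup_pm_push_inj[OF assms this] 0 show False
      by (simp add: in_keys_iff)
  qed
qed simp

lemma separating_functional:
  fixes S :: "'a::euclidean_space set"
  assumes "finite S"
  obtains y where "inj_on (\<lambda>u. u \<bullet> y) S"
proof -
  define D where "D = {u - v | u v. u \<in> S \<and> v \<in> S \<and> u \<noteq> v}"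
  have "D \<subseteq> (\<lambda>(u, v). u - v) ` (S \<times> S)"
    by (auto simp: D_def)
  then have "finite D"
    using assms by (meson finite_SigmaI finite_imageI finite_subset)
  have "negligible (\<Union>d\<in>D. {x. d \<bullet> x = 0})"
    by (rule negligible_Union)
       (use \<open>finite D\<close> in \<open>auto simp: D_def intro!: negligible_hyperplane\<close>)
  then obtain y where y: "y \<notin> (\<Union>d\<in>D. {x. d \<bullet> x = 0})"
    by (metis UNIV_I UNIV_eq_I non_negligible_UNIV)
  have "inj_on (\<lambda>u. u \<bullet> y) S"
    using y by (fastforce simp: inj_on_def D_def inner_diff_left)
  then show ?thesis
    by (rule that)
qed

lemma pm_no_zero_divisors:
  fixes f g :: "'a::euclidean_space \<Rightarrow>\<^sub>0 'k::idom"
  assumes "f \<noteq> 0" "g \<noteq> 0"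
  shows "f * g \<noteq> 0"
proof
  assume fg: "f * g = 0"
  obtain y where y: "inj_on (\<lambda>u. u \<bullet> y) (Poly_Mapping.keys f \<union> Poly_Mapping.keys g)"
    using separating_functional[of "Poly_Mapping.keys f \<union> Poly_Mapping.keys g"] by auto
  let ?h = "\<lambda>u. u \<bullet> y"
  have "pm_push ?h f * pm_push ?h g = pm_push ?h (f * g)"
    by (rule pm_push_mult[symmetric]) (simp add: inner_add_left)
  also have "\<dots> = 0"
    using fg by simp
  finally have "pm_push ?h f = 0 \<or> pm_push ?h g = 0"
    by simp
  moreover have "inj_on ?h (Poly_Mapping.keys f)" "inj_on ?h (Poly_Mapping.keys g)"
    using y by (auto intro: inj_on_subset)
  ultimately show False
    using assms pm_push_eq_0_iff by blast
qed

instance group_ring :: (euclidean_space, idom) idom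
  by standard (transfer, rule pm_no_zero_divisors)

lift_definition exponents :: "('a::euclidean_space, 'k::idom) group_ring \<Rightarrow> 'a set"
  is Poly_Mapping.keys .

text \<open>The \<open>k\<close>-linear map \<open>\<chi>\<^sup>u \<mapsto> \<chi>\<^bsup>h u\<^esup>\<close>, a ring homomorphism whenever \<open>h\<close> is additive.\<close>

lift_definition push ::
  "('a::euclidean_space \<Rightarrow> 'b::euclidean_space) \<Rightarrow> ('a, 'k::idom) group_ring \<Rightarrow> ('b, 'k) group_ring"
  is pm_push .

lemma push_mult: "(\<And>u v. h (u + v) = h u + h v) \<Longrightarrow> push h (f * g) = push h f * push h g"
  by transfer (rule pm_push_mult)

lemma push_eq_0_iff: "inj h \<Longrightarrow> push h f = 0 \<longleftrightarrow> f = 0"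
  by transfer (meson inj_on_subset pm_push_eq_0_iff subset_UNIV)


section \<open>Toric varieties\<close>

text \<open>The subring \<open>k[\<sigma>\<^sup>\<or> \<inter> M]\<close> of \<open>k[M]\<close>.\<close>

definition coord_ring :: "'a::euclidean_space set \<Rightarrow> 'a set \<Rightarrow> ('a, 'k::idom) group_ring set" where
  "coord_ring N \<sigma> = {f. exponents f \<subseteq> dual_lattice N \<inter> dual_cone \<sigma>}"

definition prime_spec :: "'r::comm_ring_1 set \<Rightarrow> 'r set set" where
  "prime_spec A = {P. P \<subset> A \<and> 0 \<in> P \<and> (\<forall>x\<in>P. \<forall>y\<in>P. x + y \<in> P) \<and> (\<forall>a\<in>A. \<forall>x\<in>P. a * x \<in> P) \<and>
     (\<forall>a\<in>A. \<forall>b\<in>A. a * b \<in> P \<longrightarrow> a \<in> P \<or> b \<in> P)}"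

definition local_ring_at :: "'r::idom set \<Rightarrow> 'r set \<Rightarrow> 'r fract set" where
  "local_ring_at A P = {Fract a b | a b. a \<in> A \<and> b \<in> A - P}"

definition max_ideal :: "'f::field set \<Rightarrow> 'f set" where
  "max_ideal R = {f \<in> R. f = 0 \<or> inverse f \<notin> R}"

text \<open>
  The scheme \<open>X(\<Sigma>)\<close> is glued from the affine schemes \<open>U\<^sub>\<sigma> = Spec k[\<sigma>\<^sup>\<or> \<inter> M]\<close>. As it is integral and
  separated, a point is determined by its local ring inside the function field, and points of
  different charts are identified in the gluing iff these local rings agree. So the points are
  taken to be the local rings (as in EGA I, 8.3).
\<close>

definition toric_points ::
    "'a::euclidean_space set \<Rightarrow> 'a set set \<Rightarrow> ('a, 'k::idom) group_ring fract set set" where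
  "toric_points N \<Sigma> =
     {local_ring_at (coord_ring N \<sigma>) P | \<sigma> P. \<sigma> \<in> \<Sigma> \<and> P \<in> prime_spec (coord_ring N \<sigma>)}"

text \<open>
  The gluing topology: a set of points is open iff its preimage in each \<open>U\<^sub>\<sigma>\<close> is Zariski open,
  i.e. the complement of the vanishing locus of some set \<open>I\<close>.
\<close>

definition toric_open ::
    "'a::euclidean_space set \<Rightarrow> 'a set set \<Rightarrow> ('a, 'k::idom) group_ring fract set set \<Rightarrow> bool" where
  "toric_open N \<Sigma> W \<longleftrightarrow> W \<subseteq> toric_points N \<Sigma> \<and>
     (\<forall>\<sigma>\<in>\<Sigma>. \<exists>I\<subseteq>coord_ring N \<sigma>. \<forall>P\<in>prime_spec (coord_ring N \<sigma>).
        local_ring_at (coord_ring N \<sigma>) P \<in> W \<longleftrightarrow> \<not> I \<subseteq> P)"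

definition toric_topology ::
    "'a::euclidean_space set \<Rightarrow> 'a set set \<Rightarrow> ('a, 'k::idom) group_ring fract set topology" where
  "toric_topology N \<Sigma> = topology (toric_open N \<Sigma>)"

lemma keys_times_subset:
  fixes f g :: "'a::monoid_add \<Rightarrow>\<^sub>0 'k::semiring_0"
  shows "Poly_Mapping.keys (f * g) \<subseteq> {u + v | u v. u \<in> Poly_Mapping.keys f \<and> v \<in> Poly_Mapping.keys g}"
  using keys_mult[of f g] by auto

lemma exponents_mult:
  "exponents (f * g) \<subseteq> {u + v | u v. u \<in> exponents f \<and> v \<in> exponents g}"
  by transfer (rule keys_times_subset)

lemma coord_ring_mult:
  assumes "f \<in> coord_ring N \<sigma>" "g \<in> coord_ring N \<sigma>"
  shows "f * g \<in> coord_ring N \<sigma>"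
proof -
  have "u + v \<in> dual_lattice N \<inter> dual_cone \<sigma>" if "u \<in> exponents f" "v \<in> exponents g" for u v
  proof -
    have "u \<in> dual_lattice N \<inter> dual_cone \<sigma>" "v \<in> dual_lattice N \<inter> dual_cone \<sigma>"
      using that assms by (auto simp: coord_ring_def)
    then show ?thesis
      by (auto simp: dual_lattice_def dual_cone_def inner_add_left)
  qed
  then show ?thesis
    using exponents_mult[of f g] by (auto simp: coord_ring_def)
qed

lemma istopology_toric_open: "istopology (toric_open N \<Sigma>)"
  unfolding istopology_def
proof (intro conjI allI impI)
  fix V W :: "('a::euclidean_space, 'k::idom) group_ring fract set set"
  assume V: "toric_open N \<Sigma> V" and W: "toric_open N \<Sigma> W"
  show "toric_open N \<Sigma> (V \<inter> W)"
    unfolding toric_open_def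
  proof (intro conjI ballI)
    show "V \<inter> W \<subseteq> toric_points N \<Sigma>"
      using V by (auto simp: toric_open_def)
  next
    fix \<sigma> assume \<sigma>: "\<sigma> \<in> \<Sigma>"
    let ?A = "coord_ring N \<sigma> :: ('a, 'k) group_ring set"
    obtain I where I: "I \<subseteq> ?A" "\<forall>P\<in>prime_spec ?A. local_ring_at ?A P \<in> V \<longleftrightarrow> \<not> I \<subseteq> P"
      using V \<sigma> unfolding toric_open_def by meson
    obtain J where J: "J \<subseteq> ?A" "\<forall>P\<in>prime_spec ?A. local_ring_at ?A P \<in> W \<longleftrightarrow> \<not> J \<subseteq> P"
      using W \<sigma> unfolding toric_open_def by meson
    define K where "K = {f * g | f g. f \<in> I \<and> g \<in> J}"
    have "K \<subseteq> ?A"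
      using I(1) J(1) by (auto simp: K_def intro!: coord_ring_mult)
    moreover have "\<not> K \<subseteq> P \<longleftrightarrow> \<not> I \<subseteq> P \<and> \<not> J \<subseteq> P" if P: "P \<in> prime_spec ?A" for P
    proof
      assume "\<not> K \<subseteq> P"
      then obtain f g where fg: "f \<in> I" "g \<in> J" "f * g \<notin> P"
        by (auto simp: K_def)
      have ideal: "a * x \<in> P" if "a \<in> ?A" "x \<in> P" for a x
        using P that by (auto simp: prime_spec_def)
      have "f \<notin> P" "g \<notin> P"
        using fg I(1) J(1) ideal[of f g] ideal[of g f] by (auto simp: mult.commute)
      then show "\<not> I \<subseteq> P \<and> \<not> J \<subseteq> P"
        using fg by auto
    next
      assume "\<not> I \<subseteq> P \<and> \<not> J \<subseteq> P"
      then obtain f g where fg: "f \<in> I" "f \<notin> P" "g \<in> J" "g \<notin> P"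
        by auto
      have "f \<in> ?A" "g \<in> ?A"
        using fg I(1) J(1) by auto
      then have "f * g \<notin> P"
        using P fg by (auto simp: prime_spec_def)
      then show "\<not> K \<subseteq> P"
        using fg by (auto simp: K_def)
    qed
    ultimately show "\<exists>K\<subseteq>?A. \<forall>P\<in>prime_spec ?A. local_ring_at ?A P \<in> V \<inter> W \<longleftrightarrow> \<not> K \<subseteq> P"
      using I(2) J(2) by (intro exI[of _ K]) auto
  qed
next
  fix \<W> :: "('a::euclidean_space, 'k::idom) group_ring fract set set set"
  assume \<W>: "\<forall>W\<in>\<W>. toric_open N \<Sigma> W"
  show "toric_open N \<Sigma> (\<Union>\<W>)"
    unfolding toric_open_def
  proof (intro conjI ballI)
    show "\<Union>\<W> \<subseteq> toric_points N \<Sigma>"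
      using \<W> by (auto simp: toric_open_def)
  next
    fix \<sigma> assume \<sigma>: "\<sigma> \<in> \<Sigma>"
    let ?A = "coord_ring N \<sigma> :: ('a, 'k) group_ring set"
    have "\<forall>W\<in>\<W>. \<exists>I\<subseteq>?A. \<forall>P\<in>prime_spec ?A. local_ring_at ?A P \<in> W \<longleftrightarrow> \<not> I \<subseteq> P"
      using \<W> \<sigma> unfolding toric_open_def by blast
    then obtain I where I: "\<forall>W\<in>\<W>. I W \<subseteq> ?A \<and>
        (\<forall>P\<in>prime_spec ?A. local_ring_at ?A P \<in> W \<longleftrightarrow> \<not> I W \<subseteq> P)"
      by metis
    then show "\<exists>K\<subseteq>?A. \<forall>P\<in>prime_spec ?A. local_ring_at ?A P \<in> \<Union>\<W> \<longleftrightarrow> \<not> K \<subseteq> P"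
      by (intro exI[of _ "\<Union>W\<in>\<W>. I W"]) (auto 0 3)
  qed
qed

lemma openin_toric_topology [simp]: "openin (toric_topology N \<Sigma>) = toric_open N \<Sigma>"
  by (simp add: toric_topology_def topology_inverse' istopology_toric_open)

text \<open>
  The sections of the structure sheaf over a nonempty open set \<open>U\<close>; restriction maps are
  inclusions. (Over the empty set the sheaf is zero; that case is never used.)
\<close>

definition sections :: "'f set set \<Rightarrow> 'f set" where
  "sections U = \<Inter>U"

text \<open>
  The ideal sheaf of a closed subvariety (reduced), given by its set \<open>Z\<close> of points: sections whose
  value in the residue field vanishes at each point of \<open>Z\<close>.
\<close>

definition ideal_sections :: "'f::field set set \<Rightarrow> 'f set set \<Rightarrow> 'f set" where
  "ideal_sections Z U = {f \<in> sections U. \<forall>R\<in>Z \<inter> U. f \<in> max_ideal R}"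

text \<open>
  The morphism \<open>F\<close> induced by multiplication by \<open>q\<close> on \<open>N\<close> restricts to \<open>U\<^sub>\<sigma> \<rightarrow> U\<^sub>\<sigma>\<close> for each cone, where
  it is given by the ring homomorphism \<open>\<chi>\<^sup>u \<mapsto> \<chi>\<^bsup>q u\<^esup>\<close>; on points it takes \<open>P\<close> to the preimage of \<open>P\<close>.
\<close>

definition mult_pullback ::
    "nat \<Rightarrow> ('a::euclidean_space, 'k::idom) group_ring \<Rightarrow> ('a, 'k) group_ring" where
  "mult_pullback q = push (\<lambda>u. real q *\<^sub>R u)"

lemma mult_pullback_mult: "mult_pullback q (f * g) = mult_pullback q f * mult_pullback q g"
  unfolding mult_pullback_def by (rule push_mult) (simp add: scaleR_add_right)

lemma mult_pullback_eq_0_iff: "q > 0 \<Longrightarrow> mult_pullback q f = 0 \<longleftrightarrow> f = 0"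
  unfolding mult_pullback_def by (rule push_eq_0_iff) (simp add: inj_on_def)

text \<open>The inverse image \<open>F\<^sup>-\<^sup>1(W)\<close> of a set of points.\<close>

definition mult_vimage :: "nat \<Rightarrow> 'a::euclidean_space set \<Rightarrow> 'a set set \<Rightarrow>
    ('a, 'k::idom) group_ring fract set set \<Rightarrow> ('a, 'k) group_ring fract set set" where
  "mult_vimage q N \<Sigma> W = {local_ring_at (coord_ring N \<sigma>) P | \<sigma> P.
     \<sigma> \<in> \<Sigma> \<and> P \<in> prime_spec (coord_ring N \<sigma>) \<and>
     local_ring_at (coord_ring N \<sigma>) {f \<in> coord_ring N \<sigma>. mult_pullback q f \<in> P} \<in> W}"

text \<open>The extension of \<open>\<chi>\<^sup>u \<mapsto> \<chi>\<^bsup>q u\<^esup>\<close> to fractions (well defined for \<open>q \<ge> 1\<close>, see below).\<close>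

definition mult_pullback_fract :: "nat \<Rightarrow>
    ('a::euclidean_space, 'k::idom) group_ring fract \<Rightarrow> ('a, 'k) group_ring fract" where
  "mult_pullback_fract q z =
     (THE w. \<exists>a b. b \<noteq> 0 \<and> z = Fract a b \<and> w = Fract (mult_pullback q a) (mult_pullback q b))"

lemma mult_pullback_fract_Fract:
  assumes "q > 0" "b \<noteq> 0"
  shows "mult_pullback_fract q (Fract a b) = Fract (mult_pullback q a) (mult_pullback q b)"
  unfolding mult_pullback_fract_def
proof (rule the_equality)
  fix w
  assume "\<exists>a' b'. b' \<noteq> 0 \<and> Fract a b = Fract a' b' \<and>
    w = Fract (mult_pullback q a') (mult_pullback q b')"
  then obtain a' b' where *: "b' \<noteq> 0" "Fract a b = Fract a' b'"
    "w = Fract (mult_pullback q a') (mult_pullback q b')"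
    by blast
  then have "a * b' = a' * b"
    using assms by (simp add: eq_fract)
  then have "mult_pullback q a * mult_pullback q b' = mult_pullback q a' * mult_pullback q b"
    by (metis mult_pullback_mult)
  then show "w = Fract (mult_pullback q a) (mult_pullback q b)"
    using * assms by (simp add: eq_fract mult_pullback_eq_0_iff)
qed (use assms in blast)


section \<open>Diagonal splittings\<close>

text \<open>
  \<open>\<pi>\<close> is an \<open>\<O>\<^sub>X\<close>-module map \<open>F\<^sub>*\<O>\<^sub>X \<rightarrow> \<O>\<^sub>X\<close>, given by its components
  \<open>\<pi> U : \<O>\<^sub>X(F\<^sup>-\<^sup>1 U) \<rightarrow> \<O>\<^sub>X(U)\<close>, that restricts to the identity along \<open>\<O>\<^sub>X \<rightarrow> F\<^sub>*\<O>\<^sub>X\<close>. The empty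
  open set is omitted since the component there is the zero map.
\<close>

definition splitting :: "nat \<Rightarrow> 'a::euclidean_space set \<Rightarrow> 'a set set \<Rightarrow>
    (('a, 'k::idom) group_ring fract set set \<Rightarrow> ('a, 'k) group_ring fract \<Rightarrow> ('a, 'k) group_ring fract)
    \<Rightarrow> bool" where
  "splitting q N \<Sigma> \<pi> \<longleftrightarrow>
     (\<forall>U. openin (toric_topology N \<Sigma>) U \<and> U \<noteq> {} \<longrightarrow>
        (\<forall>b\<in>sections (mult_vimage q N \<Sigma> U). \<pi> U b \<in> sections U) \<and>
        (\<forall>b\<in>sections (mult_vimage q N \<Sigma> U). \<forall>c\<in>sections (mult_vimage q N \<Sigma> U).
           \<pi> U (b + c) = \<pi> U b + \<pi> U c) \<and>
        (\<forall>a\<in>sections U. \<forall>b\<in>sections (mult_vimage q N \<Sigma> U).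
           \<pi> U (mult_pullback_fract q a * b) = a * \<pi> U b) \<and>
        (\<forall>a\<in>sections U. \<pi> U (mult_pullback_fract q a) = a) \<and>
        (\<forall>V. openin (toric_topology N \<Sigma>) V \<and> V \<noteq> {} \<and> V \<subseteq> U \<longrightarrow>
           (\<forall>b\<in>sections (mult_vimage q N \<Sigma> U). \<pi> V b = \<pi> U b)))"

definition compatible_splitting :: "nat \<Rightarrow> 'a::euclidean_space set \<Rightarrow> 'a set set \<Rightarrow>
    ('a, 'k::idom) group_ring fract set set \<Rightarrow>
    (('a, 'k) group_ring fract set set \<Rightarrow> ('a, 'k) group_ring fract \<Rightarrow> ('a, 'k) group_ring fract)
    \<Rightarrow> bool" where
  "compatible_splitting q N \<Sigma> Z \<pi> \<longleftrightarrow> splitting q N \<Sigma> \<pi> \<and>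
     (\<forall>U. openin (toric_topology N \<Sigma>) U \<and> U \<noteq> {} \<longrightarrow>
        \<pi> U ` ideal_sections Z (mult_vimage q N \<Sigma> U) \<subseteq> ideal_sections Z U)"

text \<open>
  The image of the diagonal morphism \<open>X \<rightarrow> X \<times> X\<close>. It maps \<open>U\<^sub>\<sigma>\<close> to \<open>U\<^sub>\<sigma> \<times> U\<^sub>\<sigma>\<close>, the chart of the cone
  \<open>\<sigma> \<times> \<sigma>\<close>, by the ring homomorphism \<open>\<chi>\<^bsup>(u, u')\<^esup> \<mapsto> \<chi>\<^bsup>u + u'\<^esup>\<close>.
\<close>

definition diagonal_points :: "'a::euclidean_space set \<Rightarrow> 'a set set \<Rightarrow>
    ('a \<times> 'a, 'k::idom) group_ring fract set set" where
  "diagonal_points N \<Sigma> =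
     {local_ring_at (coord_ring (N \<times> N) (\<sigma> \<times> \<sigma>))
        {f \<in> coord_ring (N \<times> N) (\<sigma> \<times> \<sigma>). push (\<lambda>(u, u'). u + u') f \<in> P} | \<sigma> P.
      \<sigma> \<in> \<Sigma> \<and> P \<in> prime_spec (coord_ring N \<sigma>)}"

text \<open>The toric variety over the field \<open>'k\<close> is diagonally split at \<open>q\<close>.\<close>

definition diagonally_split ::
    "'k::field itself \<Rightarrow> nat \<Rightarrow> 'a::euclidean_space set \<Rightarrow> 'a set set \<Rightarrow> bool" where
  "diagonally_split _ q N \<Sigma> \<longleftrightarrow>
     (\<exists>\<pi> :: ('a \<times> 'a, 'k) group_ring fract set set \<Rightarrow>
             ('a \<times> 'a, 'k) group_ring fract \<Rightarrow> ('a \<times> 'a, 'k) group_ring fract.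
        compatible_splitting q (N \<times> N) (product_fan \<Sigma>) (diagonal_points N \<Sigma>) \<pi>)"

end

theory Submission
  imports Defs
begin

text \<open>
  Let \<open>u \<in> M\<close>. As \<open>\<chi>\<^bsup>(u, -u)\<^esup> - 1\<close> vanishes on the diagonal, a compatible splitting maps \<open>\<chi>\<^bsup>(u, -u)\<^esup>\<close> to
  a Laurent polynomial that restricts to \<open>1\<close> on the diagonal, so it has an exponent of the form
  \<open>(w, -w)\<close>. Regularity along the divisors of \<open>X \<times> X\<close> given by the rays \<open>(v, 0)\<close> and \<open>(0, v)\<close> forces
  \<open>|\<langle>q w - u, v\<rangle>| < q\<close>. For \<open>q = 2\<close>, every class in \<open>M / 2 M\<close> therefore has a representative that
  pairs with all of \<open>\<Sigma>(1)\<close> to \<open>-1\<close>, \<open>0\<close> or \<open>1\<close>. For a basis \<open>B \<subseteq> \<Sigma>(1)\<close> of \<open>N\<^sub>\<real>\<close> a counting argument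
  modulo \<open>2\<close> then shows that the dual basis of \<open>B\<close> lies in \<open>M\<close>, i.e. \<open>B\<close> generates \<open>N\<close>.
\<close>

section \<open>Lattices\<close>

text \<open>Nothing is known about a splitting beyond its linearity: it need not respect the torus
  action, so the image of a monomial may have many exponents. The bound on pairings is therefore
  proved for every exponent of the image, and the diagonal only has to supply one exponent of the
  right shape. A second obstacle is that a nonconstant monomial is not a global function on a
  complete variety. The splitting is applied on the open locus where the monomial is regular;
  different loci are compared inside the function field, where restriction is inclusion and all of
  them share the generic point. The strict bound comes from twisting. Multiplying the monomial by
  the \<open>q\<close>-th power of a monomial with exponent \<open>m\<close> shifts the exponents of
  the image by \<open>m\<close> only, and \<open>m\<close> is chosen so that the product just
  becomes regular along one divisor. Rounding the pairing divided by \<open>q\<close> to an integer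
  loses less than 1. The value \<open>q = 2\<close> matters because an integer of absolute value
  less than 2 has its absolute value fixed by its parity.\<close>

lemma dual_basis_exists:
  fixes B :: "'a::euclidean_space set"
  assumes B: "independent B" "span B = UNIV"
  obtains d where "\<And>b c. b \<in> B \<Longrightarrow> c \<in> B \<Longrightarrow> d b \<bullet> c = (if b = c then 1 else 0)"
    and "\<And>x. x = (\<Sum>b\<in>B. (d b \<bullet> x) *\<^sub>R b)"
proof -
  have fin: "finite B"
    using B by (simp add: independent_imp_finite)
  \<comment> \<open>The adjoint evaluated at 1 is the Riesz representative of the coordinate
    functional of \<open>b\<close>.\<close>
  define d where "d b = adjoint (\<lambda>x. representation B x b) (1::real)" for b
  have lin: "linear (\<lambda>x. representation B x b)" for b
    using B by (intro linearI) (auto simp: representation_add representation_scale)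
  have d: "d b \<bullet> x = representation B x b" for b x
    using adjoint_works[OF lin[of b], of x 1] by (simp add: d_def inner_commute)
  show ?thesis
  proof
    show "d b \<bullet> c = (if b = c then 1 else 0)" if "b \<in> B" "c \<in> B" for b c
      using representation_basis[OF B(1) that(2)] by (auto simp: d)
    show "x = (\<Sum>b\<in>B. (d b \<bullet> x) *\<^sub>R b)" for x
      using sum_representation_eq[OF B(1) _ fin order_refl, of x] B(2) by (simp add: d)
  qed
qed

lemma int_span_finite:
  assumes "finite B"
  shows "int_span B = {\<Sum>b\<in>B. of_int (c b) *\<^sub>R b | c :: 'a::real_vector \<Rightarrow> int. True}"
proof (intro equalityI subsetI)
  fix x assume "x \<in> int_span B"
  then obtain T c where T: "T \<subseteq> B" "x = (\<Sum>v\<in>T. of_int (c v) *\<^sub>R v)"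
    by (auto simp: int_span_def)
  have "x = (\<Sum>b\<in>B. of_int (if b \<in> T then c b else 0) *\<^sub>R b)"
    unfolding T(2) using assms T(1) by (intro sum.mono_neutral_cong_left) auto
  then show "x \<in> {\<Sum>b\<in>B. of_int (c b) *\<^sub>R b | c :: 'a \<Rightarrow> int. True}"
    by (intro CollectI exI[of _ "\<lambda>b. if b \<in> T then c b else 0"]) simp
qed (use assms in \<open>auto simp: int_span_def\<close>)

lemma dual_latticeD: "u \<in> dual_lattice N \<Longrightarrow> v \<in> N \<Longrightarrow> u \<bullet> v \<in> \<int>"
  by (simp add: dual_lattice_def)

lemma dual_lattice_zero [simp]: "0 \<in> dual_lattice N"
  by (simp add: dual_lattice_def)

lemma dual_lattice_add: "u \<in> dual_lattice N \<Longrightarrow> w \<in> dual_lattice N \<Longrightarrow> u + w \<in> dual_lattice N"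
  by (simp add: dual_lattice_def inner_add_left)

lemma dual_lattice_minus: "u \<in> dual_lattice N \<Longrightarrow> - u \<in> dual_lattice N"
  by (simp add: dual_lattice_def)

lemma dual_lattice_diff: "u \<in> dual_lattice N \<Longrightarrow> w \<in> dual_lattice N \<Longrightarrow> u - w \<in> dual_lattice N"
  by (simp add: dual_lattice_def inner_diff_left)

lemma dual_lattice_scale: "k \<in> \<int> \<Longrightarrow> u \<in> dual_lattice N \<Longrightarrow> k *\<^sub>R u \<in> dual_lattice N"
  by (simp add: dual_lattice_def)

lemma dual_lattice_sum: "(\<And>i. i \<in> I \<Longrightarrow> f i \<in> dual_lattice N) \<Longrightarrow> sum f I \<in> dual_lattice N"
  by (induction I rule: infinite_finite_induct) (auto intro: dual_lattice_add)

text \<open>A lattice basis \<open>E\<close> with its dual basis \<open>d\<close>. Elements of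
  \<open>N\<close> are integer combinations of \<open>E\<close>, so each \<open>d e\<close> is
  integral on \<open>N\<close>; conversely a vector with integral coordinates
  \<open>d e \<bullet> x\<close> is such a combination.\<close>

lemma lattice_coordinates:
  fixes N :: "'a::euclidean_space set"
  assumes "is_lattice N"
  obtains E d where "finite E" "card E = DIM('a)" "E \<subseteq> N"
    and "\<And>e. e \<in> E \<Longrightarrow> d e \<in> dual_lattice N"
    and "\<And>e c. e \<in> E \<Longrightarrow> c \<in> E \<Longrightarrow> d e \<bullet> c = (if e = c then 1 else 0)"
    and "\<And>x. x = (\<Sum>e\<in>E. (d e \<bullet> x) *\<^sub>R e)"
    and "\<And>x. (\<And>e. e \<in> E \<Longrightarrow> d e \<bullet> x \<in> \<int>) \<Longrightarrow> x \<in> N"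
proof -
  obtain E where E: "independent E" "span E = UNIV" "N = int_span E"
    using assms by (auto simp: is_lattice_def)
  have fin: "finite E"
    using E by (simp add: independent_imp_finite)
  obtain d where d: "\<And>b c. b \<in> E \<Longrightarrow> c \<in> E \<Longrightarrow> d b \<bullet> c = (if b = c then 1 else 0)"
    "\<And>x. x = (\<Sum>b\<in>E. (d b \<bullet> x) *\<^sub>R b)"
    using dual_basis_exists[OF E(1,2)] by blast
  note N = E(3)[unfolded int_span_finite[OF fin]]
  show ?thesis
  proof
    show "card E = DIM('a)"
      using E by (metis dim_UNIV dim_eq_card_independent dim_span)
    show "E \<subseteq> N"
    proof
      fix e assume "e \<in> E"
      then have "e = (\<Sum>b\<in>E. of_int (if b = e then 1 else 0) *\<^sub>R b)"
        using fin by (simp add: if_distrib sum.delta if_distribR cong: if_cong)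
      then show "e \<in> N"
        unfolding N by (intro CollectI exI[of _ "\<lambda>b. if b = e then 1 else 0"]) simp
    qed
    show "d e \<in> dual_lattice N" if "e \<in> E" for e
      using that by (auto simp: N dual_lattice_def inner_sum_right d(1) intro!: Ints_sum)
    show "x \<in> N" if x: "\<And>e. e \<in> E \<Longrightarrow> d e \<bullet> x \<in> \<int>" for x
    proof -
      have "x = (\<Sum>b\<in>E. of_int \<lfloor>d b \<bullet> x\<rfloor> *\<^sub>R b)"
        by (subst d(2)) (use x in \<open>auto intro!: sum.cong\<close>)
      then show ?thesis
        unfolding N by (intro CollectI exI[of _ "\<lambda>b. \<lfloor>d b \<bullet> x\<rfloor>"]) simp
    qed
  qed (use fin d in auto)
qed

lemma lattice_pairing_nonzero:
  assumes "is_lattice N" "x \<noteq> 0"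
  obtains u where "u \<in> dual_lattice N" "u \<bullet> x \<noteq> 0"
proof -
  obtain E d where E: "\<And>e. e \<in> E \<Longrightarrow> d e \<in> dual_lattice N" "x = (\<Sum>e\<in>E. (d e \<bullet> x) *\<^sub>R e)"
    using lattice_coordinates[OF assms(1)] by metis
  have "\<exists>e\<in>E. d e \<bullet> x \<noteq> 0"
    using E(2) assms(2) by (metis (no_types, lifting) scaleR_zero_left sum.neutral)
  then show ?thesis
    using E(1) that by blast
qed

text \<open>The coordinates of \<open>x\<close> in a lattice basis are pairings with dual basis
  vectors, which belong to \<open>dual_lattice N\<close>.\<close>

lemma lattice_bidual:
  assumes "is_lattice N" "\<And>u. u \<in> dual_lattice N \<Longrightarrow> u \<bullet> x \<in> \<int>"
  shows "x \<in> N"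
  using lattice_coordinates[OF assms(1)] assms(2) by metis

lemma zero_in_lattice: "is_lattice N \<Longrightarrow> 0 \<in> N"
  by (rule lattice_bidual) auto

text \<open>Divide \<open>s\<close> by the largest integer \<open>m\<close> that keeps it in
  \<open>N\<close>. Such an \<open>m\<close> exists: if \<open>u\<close> in the dual lattice pairs
  nontrivially with \<open>s\<close>, then \<open>(u \<bullet> s) / m\<close> is a nonzero integer,
  so \<open>m\<close> is at most \<open>\<bar>u \<bullet> s\<bar>\<close>.\<close>

lemma primitive_multiple:
  assumes N: "is_lattice N" and s: "s \<in> N" "s \<noteq> 0"
  obtains v m where "primitive_vector N v" "m > 0" "s = real m *\<^sub>R v"
proof -
  obtain u where u: "u \<in> dual_lattice N" "u \<bullet> s \<noteq> 0"
    using lattice_pairing_nonzero N s by blast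
  define A where "A = {m. m > 0 \<and> (1 / real m) *\<^sub>R s \<in> N}"
  have bound: "real m \<le> \<bar>u \<bullet> s\<bar>" if "m \<in> A" for m
  proof -
    have m: "m > 0" "(1 / real m) *\<^sub>R s \<in> N"
      using that by (auto simp: A_def)
    have "(u \<bullet> s) / real m \<in> \<int>"
      using dual_latticeD[OF u(1) m(2)] by simp
    moreover have "(u \<bullet> s) / real m \<noteq> 0"
      using u m by simp
    ultimately have "1 \<le> \<bar>(u \<bullet> s) / real m\<bar>"
      by (rule Ints_nonzero_abs_ge1)
    then show ?thesis
      using m by (simp add: field_simps)
  qed
  have "A \<subseteq> {..nat \<lceil>\<bar>u \<bullet> s\<bar>\<rceil>}"
    using bound by (force simp: le_nat_iff le_ceiling_iff)
  then have fin: "finite A"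
    using finite_subset by blast
  have "1 \<in> A"
    using s by (simp add: A_def)
  define m where "m = Max A"
  have m: "m \<in> A"
    using fin \<open>1 \<in> A\<close> unfolding m_def by (intro Max_in) auto
  define v where "v = (1 / real m) *\<^sub>R s"
  have m0: "m > 0" and sv: "s = real m *\<^sub>R v" and v: "v \<in> N"
    using m by (auto simp: A_def v_def)
  have "k = 1" if "w \<in> N" "v = real k *\<^sub>R w" for w k
  proof -
    have k: "k > 0"
      using that sv s by (cases k) auto
    have "(1 / real (m * k)) *\<^sub>R s = w"
      using k m0 that sv by simp
    then have "m * k \<in> A"
      using that k m0 by (simp add: A_def)
    then have "m * k \<le> m"
      unfolding m_def using fin by (intro Max_ge) auto
    then show "k = 1"
      using k m0 by (cases k) auto
  qed
  moreover have "v \<noteq> 0"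
    using m0 s by (simp add: v_def)
  ultimately have "primitive_vector N v"
    using v unfolding primitive_vector_def by blast
  then show ?thesis
    using that m0 sv by blast
qed

text \<open>Division with remainder by the least positive pairing \<open>g\<close> shows that
  \<open>g\<close> divides every pairing with \<open>v\<close>. Then \<open>v / g\<close> lies in
  the bidual, hence in \<open>N\<close>, and primitivity forces \<open>g = 1\<close>.\<close>

lemma primitive_pairing_one:
  assumes N: "is_lattice N" and v: "primitive_vector N v"
  obtains m where "m \<in> dual_lattice N" "m \<bullet> v = 1"
proof -
  let ?M = "dual_lattice N"
  have vN: "v \<in> N" "v \<noteq> 0"
    using v by (auto simp: primitive_vector_def)
  obtain u where u: "u \<in> ?M" "u \<bullet> v \<noteq> 0"
    using lattice_pairing_nonzero N vN by blast
  define P where "P k \<longleftrightarrow> k > 0 \<and> (\<exists>m\<in>?M. m \<bullet> v = real k)" for k :: nat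
  obtain z where z: "u \<bullet> v = of_int z"
    using dual_latticeD[OF u(1) vN(1)] by (auto elim: Ints_cases)
  have "P (nat \<bar>z\<bar>)"
    unfolding P_def using u z
    by (cases "z \<ge> 0") (auto intro: bexI[of _ u] bexI[of _ "-u"] dual_lattice_minus)
  define g where "g = (LEAST k. P k)"
  have "P g"
    unfolding g_def using \<open>P (nat \<bar>z\<bar>)\<close> by (rule LeastI)
  then obtain m where m: "g > 0" "m \<in> ?M" "m \<bullet> v = real g"
    by (auto simp: P_def)
  have "w \<bullet> ((1 / real g) *\<^sub>R v) \<in> \<int>" if w: "w \<in> ?M" for w
  proof -
    obtain k where k: "w \<bullet> v = of_int k"
      using dual_latticeD[OF w vN(1)] by (auto elim: Ints_cases)
    define r where "r = k mod int g"
    have r: "k = (k div int g) * int g + r" "0 \<le> r" "r < int g"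
      using m by (auto simp: r_def)
    have kr: "real_of_int k = of_int (k div int g) * real g + of_int r"
      using r(1) by (metis of_int_add of_int_mult of_int_of_nat_eq)
    have "(w - of_int (k div int g) *\<^sub>R m) \<bullet> v = of_int r"
      using kr by (simp add: inner_diff_left k m)
    moreover have "w - of_int (k div int g) *\<^sub>R m \<in> ?M"
      using w m by (intro dual_lattice_diff dual_lattice_scale) auto
    ultimately have "r > 0 \<Longrightarrow> P (nat r)"
      unfolding P_def by (auto intro: bexI[of _ "w - of_int (k div int g) *\<^sub>R m"])
    moreover have "\<not> P (nat r)"
      using not_less_Least[of "nat r" P] r m(1) by (simp add: g_def nat_less_iff)
    ultimately have "r = 0"
      using r by linarith
    then show ?thesis
      using kr m k by simp
  qed
  then have "(1 / real g) *\<^sub>R v \<in> N"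
    by (intro lattice_bidual[OF N])
  moreover have "v = real g *\<^sub>R ((1 / real g) *\<^sub>R v)"
    using m by simp
  ultimately have "g = 1"
    using v unfolding primitive_vector_def by blast
  then show ?thesis
    using m that by simp
qed

section \<open>Rays of a complete fan\<close>

text \<open>A pointed cone is the cone over a polytope in a hyperplane \<open>u = 1\<close>. A
  convex combination of nonzero generators that equals 0 would put the negative of some generator,
  up to scale, into the cone; so 0 can be separated strictly from their hull, and rescaling puts
  each generator at height 1.\<close>

lemma pointed_cone_section:
  fixes S :: "'a::euclidean_space set"
  assumes S: "finite S" and pointed: "convex_cone hull S \<inter> uminus ` (convex_cone hull S) = {0}"
  obtains u T where "finite T" "convex_cone hull S = convex_cone hull T"
    "\<And>t. t \<in> T \<Longrightarrow> u \<bullet> t = 1" "\<And>t. t \<in> T \<Longrightarrow> \<exists>s\<in>S. \<exists>c>0. s = c *\<^sub>R t"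
proof -
  let ?C = "convex_cone hull S"
  define S0 where "S0 = S - {0}"
  have S0: "finite S0"
    using S by (simp add: S0_def)
  have sub: "S0 \<subseteq> ?C"
    using hull_subset[of S convex_cone] by (auto simp: S0_def)
  have sum_in: "(\<Sum>t\<in>A. c t *\<^sub>R t) \<in> ?C" if "A \<subseteq> S0" "\<And>t. t \<in> A \<Longrightarrow> c t \<ge> 0" for A c
    using finite_subset[OF that(1) S0] that
    by (induction A rule: finite_induct)
       (use sub in \<open>auto intro!: convex_cone_hull_add convex_cone_hull_mul convex_cone_hull_contains_0\<close>)
  have "0 \<notin> convex hull S0"
  proof
    assume "0 \<in> convex hull S0"
    then obtain c where c: "\<And>x. x \<in> S0 \<Longrightarrow> 0 \<le> c x" "sum c S0 = 1" "(\<Sum>x\<in>S0. c x *\<^sub>R x) = 0"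
      unfolding convex_hull_finite[OF S0] by auto
    then obtain s where s: "s \<in> S0" "c s > 0"
      by (metis less_eq_real_def not_less sum_nonpos zero_neq_one zero_less_one)
    have "c s *\<^sub>R s + (\<Sum>x\<in>S0 - {s}. c x *\<^sub>R x) = 0"
      using c(3) S0 s by (simp add: sum.remove)
    then have "- (c s *\<^sub>R s) = (\<Sum>x\<in>S0 - {s}. c x *\<^sub>R x)"
      by (simp add: minus_unique)
    also have "\<dots> \<in> ?C"
      using c(1) by (intro sum_in) auto
    finally have "c s *\<^sub>R s \<in> uminus ` ?C"
      by (metis image_eqI minus_minus)
    moreover have "c s *\<^sub>R s \<in> ?C"
      using s sub by (intro convex_cone_hull_mul) auto
    ultimately have "c s *\<^sub>R s = 0"
      using pointed by blast
    then show False
      using s by (simp add: S0_def)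
  qed
  moreover have "closed (convex hull S0)"
    using S0 by (simp add: compact_imp_closed finite_imp_compact_convex_hull)
  ultimately obtain u b where ub: "0 < b" "\<And>x. x \<in> convex hull S0 \<Longrightarrow> u \<bullet> x > b"
    using separating_hyperplane_closed_0[of "convex hull S0"] by auto
  have u: "u \<bullet> s > 0" if "s \<in> S0" for s
    using ub(1) ub(2)[OF hull_inc[OF that]] by linarith
  define T where "T = (\<lambda>s. (1 / (u \<bullet> s)) *\<^sub>R s) ` S0"
  show ?thesis
  proof
    show "finite T"
      using S0 by (simp add: T_def)
    show "?C = convex_cone hull T"
    proof
      have "s \<in> convex_cone hull T" if "s \<in> S" for s
      proof (cases "s = 0")
        case False
        then have s0: "s \<in> S0"
          using that by (simp add: S0_def)
        have "(u \<bullet> s) *\<^sub>R ((1 / (u \<bullet> s)) *\<^sub>R s) \<in> convex_cone hull T"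
          using u[OF s0] s0 by (intro convex_cone_hull_mul hull_inc) (auto simp: T_def)
        then show ?thesis
          using u[OF s0] by simp
      qed (simp add: convex_cone_hull_contains_0)
      then show "?C \<subseteq> convex_cone hull T"
        by (intro hull_minimal) (auto simp: convex_cone_convex_cone_hull)
      have "(1 / (u \<bullet> s)) *\<^sub>R s \<in> ?C" if "s \<in> S0" for s
        using that sub u[OF that] by (intro convex_cone_hull_mul) auto
      then have "T \<subseteq> ?C"
        by (auto simp: T_def)
      then show "convex_cone hull T \<subseteq> ?C"
        by (intro hull_minimal) (auto simp: convex_cone_convex_cone_hull)
    qed
    show "u \<bullet> t = 1" if "t \<in> T" for t
    proof -
      obtain s where s: "s \<in> S0" "t = (1 / (u \<bullet> s)) *\<^sub>R s"
        using \<open>t \<in> T\<close> by (auto simp: T_def)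
      then show ?thesis
        using u[OF s(1)] by simp
    qed
    show "\<exists>s\<in>S. \<exists>c>0. s = c *\<^sub>R t" if "t \<in> T" for t
    proof -
      obtain s where s: "s \<in> S0" "t = (1 / (u \<bullet> s)) *\<^sub>R s"
        using \<open>t \<in> T\<close> by (auto simp: T_def)
      then show ?thesis
        using u[OF s(1)] by (intro bexI[of _ s] exI[of _ "u \<bullet> s"]) (auto simp: S0_def)
    qed
  qed
qed

lemma convex_cone_hull_section_cases:
  assumes "x \<in> convex_cone hull T"
  obtains "x = 0" | c p where "c > 0" "p \<in> convex hull T" "x = c *\<^sub>R p"
proof (cases "T = {}")
  case False
  then obtain p c where *: "p \<in> convex hull T" "c \<ge> 0" "x = c *\<^sub>R p"
    using assms by (auto simp: convex_cone_hull_convex_hull_nonempty)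
  then show ?thesis
    using that(1) that(2)[of c p] by (cases "c = 0") auto
qed (use assms that in auto)

lemma inner_convex_hull_eq_1:
  assumes "\<And>t. t \<in> T \<Longrightarrow> u \<bullet> t = 1" "p \<in> convex hull T"
  shows "u \<bullet> p = 1"
proof -
  have "convex hull T \<subseteq> {x. u \<bullet> x = 1}"
    using assms(1) by (intro hull_minimal) (auto simp: convex_hyperplane)
  then show ?thesis
    using assms(2) by auto
qed

text \<open>The functional \<open>u\<close> of the section is positive on the cone away from 0. This
  provides the chart of the dense torus in every fan.\<close>

lemma zero_cone_face:
  assumes "rational_cone N \<sigma>"
  shows "cone_face {0} \<sigma>"
proof -
  obtain S where S: "finite S" "\<sigma> = convex_cone hull S" "\<sigma> \<inter> uminus ` \<sigma> = {0}"
    using assms by (auto simp: rational_cone_def)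
  obtain u T where T: "\<sigma> = convex_cone hull T" "\<And>t. t \<in> T \<Longrightarrow> u \<bullet> t = 1"
    using pointed_cone_section[of S] S by metis
  have pos: "x = 0 \<or> u \<bullet> x > 0" if x: "x \<in> \<sigma>" for x
    using x unfolding T(1)
    by (cases rule: convex_cone_hull_section_cases) (auto simp: inner_convex_hull_eq_1[OF T(2)])
  have "u \<in> dual_cone \<sigma>"
    using pos by (force simp: dual_cone_def)
  moreover have "{0} = \<sigma> \<inter> {v. u \<bullet> v = 0}"
    using pos T(1) by (force simp: convex_cone_hull_contains_0)
  ultimately show ?thesis
    by (auto simp: cone_face_def)
qed

lemma zero_cone_in_fan: "fan N \<Sigma> \<Longrightarrow> {0} \<in> \<Sigma>"
  using zero_cone_face unfolding fan_def by blast

text \<open>The cone lies over a polytope, which is the hull of its vertices, and each vertex spans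
  a ray that is a face of the cone and contains a primitive lattice vector.\<close>

lemma rational_cone_subset_span_rays:
  assumes N: "is_lattice N" and \<sigma>: "rational_cone N \<sigma>"
  shows "\<sigma> \<subseteq> span {v. primitive_vector N v \<and> cone_face {t *\<^sub>R v | t. t \<ge> 0} \<sigma>}"
proof -
  let ?R = "{v. primitive_vector N v \<and> cone_face {t *\<^sub>R v | t. t \<ge> 0} \<sigma>}"
  obtain S where S: "finite S" "S \<subseteq> N" "\<sigma> = convex_cone hull S" "\<sigma> \<inter> uminus ` \<sigma> = {0}"
    using \<sigma> by (auto simp: rational_cone_def)
  obtain u T where T: "finite T" "\<sigma> = convex_cone hull T" "\<And>t. t \<in> T \<Longrightarrow> u \<bullet> t = 1"
    "\<And>t. t \<in> T \<Longrightarrow> \<exists>s\<in>S. \<exists>c>0. s = c *\<^sub>R t"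
    using pointed_cone_section[of S] S by metis
  let ?P = "convex hull T"
  have P1: "u \<bullet> x = 1" if "x \<in> ?P" for x
    using inner_convex_hull_eq_1 T(3) that by blast
  have vertex: "p \<in> span ?R" if p: "p extreme_point_of ?P" for p
  proof -
    have pT: "p \<in> T"
      using p by (rule extreme_point_of_convex_hull)
    have "{p} exposed_face_of ?P"
      using p T(1) by (simp add: exposed_face_of_polyhedron polyhedron_convex_hull face_of_singleton)
    then obtain a b where ab: "?P \<subseteq> {x. a \<bullet> x \<le> b}" "{p} = ?P \<inter> {x. a \<bullet> x = b}"
      unfolding exposed_face_of_def by auto
    \<comment> \<open>As \<open>u\<close> is 1 on the polytope, the affine function
      \<open>b - a \<bullet> x\<close> exposing the vertex agrees there with a linear one, as
      \<open>cone_face\<close> demands.\<close>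
    define w where "w = b *\<^sub>R u - a"
    have w: "w \<bullet> x = b - a \<bullet> x" if "x \<in> ?P" for x
      using P1[OF that] by (simp add: w_def inner_diff_left)
    have "w \<bullet> x \<ge> 0" if x: "x \<in> \<sigma>" for x
      using x unfolding T(2)
      by (cases rule: convex_cone_hull_section_cases) (use ab w in \<open>auto simp: subset_iff\<close>)
    then have wd: "w \<in> dual_cone \<sigma>"
      by (simp add: dual_cone_def)
    have "p \<in> ?P \<inter> {x. a \<bullet> x = b}"
      using ab(2) by (rule subst) simp
    then have "w \<bullet> p = 0"
      using w by simp
    have face: "\<sigma> \<inter> {x. w \<bullet> x = 0} = {t *\<^sub>R p | t. t \<ge> 0}"
    proof (intro equalityI subsetI)
      fix x assume x: "x \<in> \<sigma> \<inter> {x. w \<bullet> x = 0}"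
      then have "x \<in> convex_cone hull T"
        using T by simp
      then show "x \<in> {t *\<^sub>R p | t. t \<ge> 0}"
      proof (cases rule: convex_cone_hull_section_cases)
        case 1
        then show ?thesis
          by (auto intro: exI[of _ 0])
      next
        case (2 c y)
        then have "w \<bullet> y = 0"
          using x by simp
        then have "y \<in> ?P \<inter> {x. a \<bullet> x = b}"
          using w 2 by simp
        then have "y = p"
          by (simp only: ab(2)[symmetric] singleton_iff)
        then show ?thesis
          using 2 by (auto intro: exI[of _ c])
      qed
    next
      fix x assume "x \<in> {t *\<^sub>R p | t. t \<ge> 0}"
      then show "x \<in> \<sigma> \<inter> {x. w \<bullet> x = 0}"
        using \<open>w \<bullet> p = 0\<close> hull_inc[OF pT, of convex_cone]
        by (auto simp: T(2) convex_cone_hull_mul)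
    qed
    \<comment> \<open>Rationality of the ray: the vertex is a rescaled generator from
      \<open>S\<close>, and \<open>S\<close> lies in \<open>N\<close>.\<close>
    obtain s c where s: "s \<in> S" "c > 0" "s = c *\<^sub>R p"
      using T(4)[OF pT] by blast
    have "s \<noteq> 0"
      using s T(3)[OF pT] by auto
    then obtain v m where v: "primitive_vector N v" "m > 0" "s = real m *\<^sub>R v"
      using primitive_multiple[OF N] s S(2) by blast
    define k where "k = real m / c"
    have k: "k > 0"
      using s v by (simp add: k_def)
    have "p = (1 / c) *\<^sub>R s"
      using s by simp
    then have pv: "p = k *\<^sub>R v"
      unfolding v(3) by (simp add: k_def)
    have "{t *\<^sub>R p | t. t \<ge> 0} = {t *\<^sub>R v | t. t \<ge> 0}"
    proof (intro equalityI subsetI)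
      fix x assume "x \<in> {t *\<^sub>R v | t. t \<ge> 0}"
      then obtain t where t: "t \<ge> 0" "x = t *\<^sub>R v"
        by blast
      then have "x = (t / k) *\<^sub>R p" "t / k \<ge> 0"
        using k by (simp_all add: pv)
      then show "x \<in> {t *\<^sub>R p | t. t \<ge> 0}"
        by blast
    next
      fix x assume "x \<in> {t *\<^sub>R p | t. t \<ge> 0}"
      then obtain t where t: "t \<ge> 0" "x = t *\<^sub>R p"
        by blast
      then have "x = (t * k) *\<^sub>R v" "t * k \<ge> 0"
        using k by (simp_all add: pv)
      then show "x \<in> {t *\<^sub>R v | t. t \<ge> 0}"
        by blast
    qed
    then have "cone_face {t *\<^sub>R v | t. t \<ge> 0} \<sigma>"
      unfolding cone_face_def face[symmetric] using wd by metis
    then have "v \<in> ?R"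
      using v by blast
    then show ?thesis
      unfolding pv by (intro span_scale span_base)
  qed
  have "?P = convex hull {x. x extreme_point_of ?P}"
    using T(1) by (intro Krein_Milman_Minkowski) (auto simp: finite_imp_compact_convex_hull)
  also have "\<dots> \<subseteq> span ?R"
    using vertex by (intro hull_minimal) (auto simp: subspace_imp_convex)
  finally have P: "?P \<subseteq> span ?R" .
  show ?thesis
  proof
    fix x assume "x \<in> \<sigma>"
    then have "x \<in> convex_cone hull T"
      using T by simp
    then show "x \<in> span ?R"
      by (cases rule: convex_cone_hull_section_cases) (use P in \<open>auto intro: span_zero span_scale\<close>)
  qed
qed

lemma span_ray_generators:
  assumes "is_lattice N" "complete_fan N \<Sigma>"
  shows "span (ray_generators N \<Sigma>) = UNIV"
proof -
  have "x \<in> span (ray_generators N \<Sigma>)" for x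
  proof -
    obtain \<sigma> where \<sigma>: "\<sigma> \<in> \<Sigma>" "x \<in> \<sigma>"
      using assms(2) unfolding complete_fan_def by blast
    have rat: "rational_cone N \<sigma>" and faces: "\<And>\<tau>. cone_face \<tau> \<sigma> \<Longrightarrow> \<tau> \<in> \<Sigma>"
      using assms(2) \<sigma> unfolding complete_fan_def fan_def by blast+
    have "x \<in> span {v. primitive_vector N v \<and> cone_face {t *\<^sub>R v | t. t \<ge> 0} \<sigma>}"
      using rational_cone_subset_span_rays[OF assms(1) rat] \<sigma>(2) by (rule subsetD)
    also have "\<dots> \<subseteq> span (ray_generators N \<Sigma>)"
      using faces by (intro span_mono) (auto simp: ray_generators_def)
    finally show ?thesis .
  qed
  then show ?thesis
    by auto
qed

section \<open>Monomials in the group ring\<close>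

lift_definition gr_single :: "'a::euclidean_space \<Rightarrow> 'k::idom \<Rightarrow> ('a, 'k) group_ring"
  is Poly_Mapping.single .

abbreviation chi :: "'a::euclidean_space \<Rightarrow> ('a, 'k::idom) group_ring" where
  "chi u \<equiv> gr_single u 1"

lift_definition coefficient :: "('a::euclidean_space, 'k::idom) group_ring \<Rightarrow> 'a \<Rightarrow> 'k"
  is Poly_Mapping.lookup .

lemma finite_exponents [simp]: "finite (exponents f)"
  by transfer simp

lemma exponents_zero [simp]: "exponents 0 = {}"
  by transfer simp

lemma exponents_single: "exponents (gr_single u c) \<subseteq> {u}"
  by transfer simp

lemma exponents_chi [simp]: "exponents (chi u) = {u}"
  by transfer simp

lemma exponents_add: "exponents (f + g) \<subseteq> exponents f \<union> exponents g"
  by transfer (rule Poly_Mapping.keys_add)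

lemma exponents_diff: "exponents (f - g) \<subseteq> exponents f \<union> exponents g"
  by transfer (auto simp: in_keys_iff lookup_minus)

lemma exponents_sum: "exponents (sum f I) \<subseteq> (\<Union>i\<in>I. exponents (f i))"
  by (induction I rule: infinite_finite_induct) (use exponents_add in fastforce)+

lemma gr_single_mult: "gr_single u c * gr_single v d = gr_single (u + v) (c * d)"
  by transfer (simp add: mult_single)

lemma chi_0 [simp]: "chi 0 = 1"
  by transfer (rule single_one)

lemma Rep_group_ring_sum: "Rep_group_ring (sum f I) = (\<Sum>i\<in>I. Rep_group_ring (f i))"
  by (induction I rule: infinite_finite_induct) (auto simp: zero_group_ring.rep_eq plus_group_ring.rep_eq)

lemma group_ring_expand: "f = (\<Sum>u\<in>exponents f. gr_single u (coefficient f u))"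
  by (rule Rep_group_ring_inject[THEN iffD1])
     (simp add: Rep_group_ring_sum exponents.rep_eq gr_single.rep_eq coefficient.rep_eq
        flip: pm_expand)

lemma push_zero [simp]: "push h 0 = 0"
  by transfer simp

lemma push_single [simp]: "push h (gr_single u c) = gr_single (h u) c"
  by transfer simp

lemma push_add: "push h (f + g) = push h f + push h g"
  by transfer (rule pm_push_add)

lemma push_diff: "push h (f - g) = push h f - push h g"
  using push_add[of h "f - g" g] by (simp add: eq_diff_eq)

lemma push_sum: "push h (sum f I) = (\<Sum>i\<in>I. push h (f i))"
  by (induction I rule: infinite_finite_induct) (auto simp: push_add)

lemma exponents_push: "exponents (push h f) \<subseteq> h ` exponents f"
proof -
  have "push h f = (\<Sum>u\<in>exponents f. gr_single (h u) (coefficient f u))"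
    by (subst group_ring_expand) (simp add: push_sum)
  then show ?thesis
    using exponents_sum exponents_single by fastforce
qed

lemma chi_mult_eq_push: "chi w * f = push (\<lambda>u. w + u) f"
proof -
  have "chi w * f = (\<Sum>u\<in>exponents f. gr_single (w + u) (coefficient f u))"
    by (subst (1) group_ring_expand[of f]) (simp add: sum_distrib_left gr_single_mult)
  also have "\<dots> = push (\<lambda>u. w + u) f"
    by (subst (3) group_ring_expand[of f]) (simp add: push_sum)
  finally show ?thesis .
qed

text \<open>A monomial is a unit, so translating back by its inverse gives the inclusion from right
  to left.\<close>

lemma exponents_chi_mult: "exponents (chi w * f) = (\<lambda>u. w + u) ` exponents f"
proof
  show "exponents (chi w * f) \<subseteq> (\<lambda>u. w + u) ` exponents f"
    unfolding chi_mult_eq_push by (rule exponents_push)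
  have "chi (- w) * (chi w * f) = f"
    by (simp add: gr_single_mult flip: mult.assoc)
  then have "exponents f \<subseteq> (\<lambda>u. - w + u) ` exponents (chi w * f)"
    using exponents_push[of "\<lambda>u. - w + u" "chi w * f"] by (simp only: chi_mult_eq_push)
  then show "(\<lambda>u. w + u) ` exponents f \<subseteq> exponents (chi w * f)"
    by (auto simp: image_subset_iff)
qed

section \<open>Coordinate rings and local rings\<close>

abbreviation embed :: "'r::idom \<Rightarrow> 'r fract" where
  "embed a \<equiv> Fract a 1"

section \<open>Primes and localizations of a subring\<close>

definition subring_set :: "'r::comm_ring_1 set \<Rightarrow> bool" where
  "subring_set A \<longleftrightarrow> 0 \<in> A \<and> 1 \<in> A \<and> (\<forall>a\<in>A. \<forall>b\<in>A. a + b \<in> A \<and> a * b \<in> A)"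

text \<open>Zorn's lemma gives an ideal maximal among those that contain \<open>J\<close> but not 1;
  such an ideal is prime.\<close>

lemma prime_spec_extends_ideal:
  fixes A :: "'r::comm_ring_1 set"
  assumes A: "subring_set A"
    and J: "J \<subseteq> A" "0 \<in> J" "1 \<notin> J" "\<And>x y. x \<in> J \<Longrightarrow> y \<in> J \<Longrightarrow> x + y \<in> J"
      "\<And>a x. a \<in> A \<Longrightarrow> x \<in> J \<Longrightarrow> a * x \<in> J"
  obtains P where "P \<in> prime_spec A" "J \<subseteq> P"
proof -
  define \<I> where "\<I> = {I. I \<subseteq> A \<and> J \<subseteq> I \<and> 1 \<notin> I \<and> (\<forall>x\<in>I. \<forall>y\<in>I. x + y \<in> I) \<and>
    (\<forall>a\<in>A. \<forall>x\<in>I. a * x \<in> I)}"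
  have "\<Union>\<C> \<in> \<I>" if ne: "\<C> \<noteq> {}" and chain: "subset.chain \<I> \<C>" for \<C>
  proof -
    have sub: "\<C> \<subseteq> \<I>" and tot: "\<And>X Y. X \<in> \<C> \<Longrightarrow> Y \<in> \<C> \<Longrightarrow> X \<subseteq> Y \<or> Y \<subseteq> X"
      using chain by (auto simp: subset_chain_def)
    have add: "x + y \<in> \<Union>\<C>" if XY: "X \<in> \<C>" "x \<in> X" "Y \<in> \<C>" "y \<in> Y" for x y X Y
    proof -
      obtain W where "W \<in> \<C>" "x \<in> W" "y \<in> W"
        using tot[of X Y] XY by blast
      then show ?thesis
        using sub by (auto simp: \<I>_def)
    qed
    show ?thesis
      unfolding \<I>_def
    proof (intro CollectI conjI ballI)
      show "J \<subseteq> \<Union>\<C>" "1 \<notin> \<Union>\<C>" "\<Union>\<C> \<subseteq> A"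
        using ne sub unfolding \<I>_def by blast+
    next
      fix x y assume "x \<in> \<Union>\<C>" "y \<in> \<Union>\<C>"
      then show "x + y \<in> \<Union>\<C>"
        using add by blast
    next
      fix a x assume "a \<in> A" "x \<in> \<Union>\<C>"
      then show "a * x \<in> \<Union>\<C>"
        using sub unfolding \<I>_def by blast
    qed
  qed
  moreover have "J \<in> \<I>"
    using J by (simp add: \<I>_def)
  then have "\<I> \<noteq> {}"
    by blast
  ultimately obtain P where P: "P \<in> \<I>" and max: "\<And>X. X \<in> \<I> \<Longrightarrow> P \<subseteq> X \<Longrightarrow> X = P"
    using subset_Zorn_nonempty[of \<I>] by metis
  have PA: "P \<subseteq> A" "J \<subseteq> P" "1 \<notin> P"
    and Padd: "\<And>x y. x \<in> P \<Longrightarrow> y \<in> P \<Longrightarrow> x + y \<in> P"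
    and Pmult: "\<And>a x. a \<in> A \<Longrightarrow> x \<in> P \<Longrightarrow> a * x \<in> P"
    using P by (auto simp: \<I>_def)
  have A': "0 \<in> A" "1 \<in> A" "\<And>a b. a \<in> A \<Longrightarrow> b \<in> A \<Longrightarrow> a + b \<in> A"
    "\<And>a b. a \<in> A \<Longrightarrow> b \<in> A \<Longrightarrow> a * b \<in> A"
    using A by (auto simp: subring_set_def)
  have prime: "b \<in> P" if ab: "a \<in> A" "b \<in> A" "a * b \<in> P" "a \<notin> P" for a b
  proof -
    \<comment> \<open>This ideal is strictly larger than \<open>P\<close>, so it contains 1.
      Multiplying \<open>1 = x + a * y\<close> by \<open>b\<close> writes \<open>b\<close> as an
      element of \<open>P\<close>.\<close>
    define Q where "Q = {x + a * y | x y. x \<in> P \<and> y \<in> A}"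
    have "P \<subseteq> Q"
    proof
      fix x assume "x \<in> P"
      then show "x \<in> Q"
        unfolding Q_def using A' by (intro CollectI exI[of _ x] exI[of _ 0]) simp
    qed
    have "0 \<in> P"
      using J(2) PA(2) by blast
    then have "a \<in> Q"
      unfolding Q_def using A' by (intro CollectI exI[of _ 0] exI[of _ 1]) simp
    have "Q \<notin> \<I>"
      using max[of Q] \<open>P \<subseteq> Q\<close> \<open>a \<in> Q\<close> ab by blast
    moreover have "Q \<subseteq> A"
      unfolding Q_def using PA ab(1) A' by blast
    moreover have "J \<subseteq> Q"
      using PA \<open>P \<subseteq> Q\<close> by blast
    moreover have "x + y \<in> Q" if xy: "x \<in> Q" "y \<in> Q" for x y
    proof -
      obtain x1 x2 y1 y2 where *: "x = x1 + a * x2" "y = y1 + a * y2" "x1 \<in> P" "y1 \<in> P"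
        "x2 \<in> A" "y2 \<in> A"
        using xy unfolding Q_def by blast
      have "x + y = (x1 + y1) + a * (x2 + y2)"
        by (simp add: * algebra_simps)
      then show ?thesis
        unfolding Q_def using * Padd A' by blast
    qed
    moreover have "c * x \<in> Q" if cx: "c \<in> A" "x \<in> Q" for c x
    proof -
      obtain x1 x2 where *: "x = x1 + a * x2" "x1 \<in> P" "x2 \<in> A"
        using cx unfolding Q_def by blast
      have "c * x = c * x1 + a * (c * x2)"
        by (simp add: * algebra_simps)
      then show ?thesis
        unfolding Q_def using * cx Pmult A' by blast
    qed
    ultimately have "1 \<in> Q"
      unfolding \<I>_def by blast
    then obtain x y where xy: "1 = x + a * y" "x \<in> P" "y \<in> A"
      unfolding Q_def by blast
    have "b = b * (x + a * y)"
      by (simp flip: xy(1))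
    also have "\<dots> = b * x + y * (a * b)"
      by (simp add: algebra_simps)
    finally show ?thesis
      using Padd[OF Pmult[OF ab(2) xy(2)] Pmult[OF xy(3) ab(3)]] by simp
  qed
  show ?thesis
  proof
    show "P \<in> prime_spec A"
      unfolding prime_spec_def
    proof (intro CollectI conjI ballI impI)
      show "P \<subset> A" "0 \<in> P"
        using PA J(2) A'(2) by auto
      show "a \<in> P \<or> b \<in> P" if "a \<in> A" "b \<in> A" "a * b \<in> P" for a b
        using prime[OF that] by (cases "a \<in> P") auto
    qed (fact Padd Pmult)+
    show "J \<subseteq> P"
      by (fact PA(2))
  qed
qed

lemma prime_specD:
  assumes "P \<in> prime_spec A"
  shows "P \<subseteq> A" "0 \<in> P" "x \<in> P \<Longrightarrow> y \<in> P \<Longrightarrow> x + y \<in> P" "a \<in> A \<Longrightarrow> x \<in> P \<Longrightarrow> a * x \<in> P"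
    "a \<in> A \<Longrightarrow> b \<in> A \<Longrightarrow> a * b \<in> P \<Longrightarrow> a \<in> P \<or> b \<in> P"
  using assms unfolding prime_spec_def by blast+

lemma one_notin_prime:
  assumes "P \<in> prime_spec A"
  shows "1 \<notin> P"
proof
  assume "1 \<in> P"
  then have "A \<subseteq> P"
    using prime_specD(4)[OF assms, of _ 1] by auto
  then show False
    using assms by (auto simp: prime_spec_def)
qed

lemma embed_in_local_ring:
  assumes "subring_set A" "P \<in> prime_spec A" "a \<in> A"
  shows "embed a \<in> local_ring_at A P"
  using assms one_notin_prime[OF assms(2)] unfolding local_ring_at_def subring_set_def by blast

lemma local_ring_atE:
  assumes "z \<in> local_ring_at A P" "0 \<in> P"
  obtains a b where "a \<in> A" "b \<in> A" "b \<notin> P" "b \<noteq> 0" "z = Fract a b"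
  using assms unfolding local_ring_at_def by blast

text \<open>The ideal of all possible denominators of \<open>z\<close>. A single ideal describes all
  the points where \<open>z\<close> is regular, which serves both for openness and for intersecting
  local rings.\<close>

definition denominators :: "'r::idom set \<Rightarrow> 'r fract \<Rightarrow> 'r set" where
  "denominators A z = {b \<in> A. \<exists>a\<in>A. z * embed b = embed a}"

lemma local_ring_iff_denominators:
  assumes "P \<in> prime_spec A"
  shows "z \<in> local_ring_at A P \<longleftrightarrow> \<not> denominators A z \<subseteq> P"
proof
  assume "z \<in> local_ring_at A P"
  then obtain a b where ab: "a \<in> A" "b \<in> A" "b \<notin> P" "b \<noteq> 0" "z = Fract a b"
    by (rule local_ring_atE) (rule prime_specD(2)[OF assms])
  then have "z * embed b = embed a"
    by (simp add: eq_fract)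
  then show "\<not> denominators A z \<subseteq> P"
    using ab unfolding denominators_def by blast
next
  assume "\<not> denominators A z \<subseteq> P"
  then obtain a b where ab: "a \<in> A" "b \<in> A" "b \<notin> P" "z * embed b = embed a"
    unfolding denominators_def by blast
  then have "b \<noteq> 0"
    using prime_specD(2)[OF assms] by blast
  have "z = z * embed b * Fract 1 b"
    using \<open>b \<noteq> 0\<close> by (simp add: mult.assoc One_fract_def eq_fract(1))
  also have "\<dots> = Fract a b"
    unfolding ab(4) by simp
  finally show "z \<in> local_ring_at A P"
    using ab unfolding local_ring_at_def by blast
qed

text \<open>If 1 were not a denominator of \<open>z\<close>, a prime containing the ideal of
  denominators would be a point where \<open>z\<close> is not regular.\<close>

lemma Inter_local_rings:
  fixes A :: "'r::idom set"
  assumes A: "subring_set A" and z: "\<And>P. P \<in> prime_spec A \<Longrightarrow> z \<in> local_ring_at A P"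
  obtains a where "a \<in> A" "z = embed a"
proof -
  let ?J = "denominators A z"
  have A': "0 \<in> A" "1 \<in> A" "\<And>a b. a \<in> A \<Longrightarrow> b \<in> A \<Longrightarrow> a + b \<in> A"
    "\<And>a b. a \<in> A \<Longrightarrow> b \<in> A \<Longrightarrow> a * b \<in> A"
    using A by (auto simp: subring_set_def)
  have "1 \<in> ?J"
  proof (rule ccontr)
    assume 1: "1 \<notin> ?J"
    have 0: "0 \<in> ?J"
      unfolding denominators_def using A' by (auto simp: fract_collapse intro!: bexI[of _ 0])
    have add: "x + y \<in> ?J" if xy: "x \<in> ?J" "y \<in> ?J" for x y
    proof -
      obtain a b where ab: "a \<in> A" "b \<in> A" "z * embed x = embed a" "z * embed y = embed b"
        using xy unfolding denominators_def by blast
      have "z * embed (x + y) = z * embed x + z * embed y"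
        by (simp flip: distrib_left)
      also have "\<dots> = embed (a + b)"
        by (simp add: ab)
      finally show ?thesis
        using ab xy A' unfolding denominators_def by blast
    qed
    have mult: "c * x \<in> ?J" if cx: "c \<in> A" "x \<in> ?J" for c x
    proof -
      obtain a where a: "a \<in> A" "z * embed x = embed a"
        using cx unfolding denominators_def by blast
      have "z * embed (c * x) = embed c * (z * embed x)"
        by (simp add: mult.left_commute)
      also have "\<dots> = embed (c * a)"
        by (simp add: a)
      finally show ?thesis
        using a cx A' unfolding denominators_def by blast
    qed
    have "?J \<subseteq> A"
      by (auto simp: denominators_def)
    from prime_spec_extends_ideal[OF A this 0 1 add mult]
    obtain P where "P \<in> prime_spec A" "?J \<subseteq> P"
      by blast
    then show False
      using z local_ring_iff_denominators by blast
  qed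
  then show ?thesis
    using that by (auto simp: denominators_def fract_collapse)
qed

section \<open>Coordinate rings of cones\<close>

lemma subring_coord_ring:
  "subring_set (coord_ring N \<sigma> :: ('a::euclidean_space, 'k::idom) group_ring set)"
proof -
  let ?A = "coord_ring N \<sigma> :: ('a, 'k) group_ring set"
  have "chi 0 \<in> ?A"
    unfolding coord_ring_def mem_Collect_eq exponents_chi by (simp add: dual_cone_def)
  moreover have "a + b \<in> ?A" if "a \<in> ?A" "b \<in> ?A" for a b
    using that exponents_add[of a b] unfolding coord_ring_def by blast
  moreover have "0 \<in> ?A"
    by (simp add: coord_ring_def)
  ultimately show ?thesis
    by (simp add: subring_set_def coord_ring_mult)
qed

lemma coord_ring_diff:
  "f \<in> coord_ring N \<sigma> \<Longrightarrow> g \<in> coord_ring N \<sigma> \<Longrightarrow> f - g \<in> coord_ring N \<sigma>"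
  using exponents_diff[of f g] unfolding coord_ring_def by blast

lemma chi_in_coord_ring_iff:
  "chi u \<in> coord_ring N \<sigma> \<longleftrightarrow> u \<in> dual_lattice N \<and> u \<in> dual_cone \<sigma>"
  by (simp add: coord_ring_def)

lemma dual_cone_0 [simp]: "dual_cone {0} = UNIV"
  by (auto simp: dual_cone_def)

text \<open>Denominators of monomials may be taken to be monomials. In \<open>chi w * b = a\<close>
  some monomial \<open>chi m\<close> of \<open>b\<close> lies outside \<open>P\<close>, since
  otherwise \<open>b\<close> would lie in \<open>P\<close>; and \<open>m + w\<close> is then an
  exponent of \<open>a\<close>.\<close>

lemma chi_in_local_ringE:
  assumes P: "P \<in> prime_spec (coord_ring N \<sigma> :: ('a::euclidean_space, 'k::idom) group_ring set)"
    and w: "embed (chi w) \<in> local_ring_at (coord_ring N \<sigma>) P"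
  obtains m where "m \<in> dual_lattice N" "m \<in> dual_cone \<sigma>" "chi m \<notin> P" "m + w \<in> dual_cone \<sigma>"
proof -
  let ?A = "coord_ring N \<sigma> :: ('a, 'k) group_ring set"
  obtain a b where ab: "a \<in> ?A" "b \<in> ?A" "b \<notin> P" "b \<noteq> 0" "embed (chi w) = Fract a b"
    using w by (rule local_ring_atE) (rule prime_specD(2)[OF P])
  then have eq: "chi w * b = a"
    by (simp add: eq_fract)
  have "\<exists>m\<in>exponents b. chi m \<notin> P"
  proof (rule ccontr)
    assume "\<not> (\<exists>m\<in>exponents b. chi m \<notin> P)"
    then have chi: "chi m \<in> P" if "m \<in> exponents b" for m
      using that by blast
    have single: "gr_single m (coefficient b m) \<in> P" if "m \<in> exponents b" for m
    proof -
      have "gr_single 0 (coefficient b m) \<in> ?A"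
        using exponents_single[of 0 "coefficient b m"] by (force simp: coord_ring_def dual_cone_def)
      then have "gr_single 0 (coefficient b m) * chi m \<in> P"
        using chi[OF that] by (intro prime_specD(4)[OF P])
      then show ?thesis
        by (simp add: gr_single_mult)
    qed
    have "S \<subseteq> exponents b \<Longrightarrow> (\<Sum>m\<in>S. gr_single m (coefficient b m)) \<in> P" if "finite S" for S
      using that
      by (induction S rule: finite_induct) (auto intro: prime_specD[OF P] single)
    from this[of "exponents b"] have "b \<in> P"
      by (simp flip: group_ring_expand)
    then show False
      using ab(3) by blast
  qed
  then obtain m where m: "m \<in> exponents b" "chi m \<notin> P"
    by blast
  have "w + m \<in> exponents a"
    using m exponents_chi_mult[of w b] eq by auto
  then show ?thesis
    using m ab that[of m] by (auto simp: coord_ring_def add.commute)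
qed

text \<open>This is where normality of toric varieties enters.\<close>

lemma chi_in_local_ring_saturated:
  assumes P: "P \<in> prime_spec (coord_ring N \<sigma> :: ('a::euclidean_space, 'k::idom) group_ring set)"
    and q: "q > 0" and wM: "w \<in> dual_lattice N"
    and w: "embed (chi (real q *\<^sub>R w)) \<in> local_ring_at (coord_ring N \<sigma>) P"
  shows "embed (chi w) \<in> local_ring_at (coord_ring N \<sigma>) P"
proof -
  obtain m where m: "m \<in> dual_lattice N" "m \<in> dual_cone \<sigma>" "chi m \<notin> P"
    "m + real q *\<^sub>R w \<in> dual_cone \<sigma>"
    using chi_in_local_ringE[OF P w] by blast
  have "m + w \<in> dual_cone \<sigma>"
    unfolding dual_cone_def
  proof (intro CollectI ballI)
    fix v assume v: "v \<in> \<sigma>"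
    have *: "m \<bullet> v \<ge> 0" "m \<bullet> v + real q * (w \<bullet> v) \<ge> 0"
      using m v by (auto simp: dual_cone_def inner_add_left)
    \<comment> \<open>If \<open>w \<bullet> v\<close> is negative, it is at least \<open>q\<close>
      times itself, so the bound for \<open>m + q w\<close> suffices; otherwise the bound for
      \<open>m\<close> does.\<close>
    show "(m + w) \<bullet> v \<ge> 0"
    proof (cases "w \<bullet> v < 0")
      case True
      then have "real q * (w \<bullet> v) \<le> 1 * (w \<bullet> v)"
        using q by (intro mult_right_mono_neg) auto
      then show ?thesis
        using * unfolding inner_add_left by linarith
    qed (use * in \<open>auto simp: inner_add_left\<close>)
  qed
  then have "chi (m + w) \<in> (coord_ring N \<sigma> :: ('a, 'k) group_ring set)"
    using m wM by (simp add: chi_in_coord_ring_iff dual_lattice_add)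
  moreover have "chi m \<in> (coord_ring N \<sigma> :: ('a, 'k) group_ring set)"
    using m by (simp add: chi_in_coord_ring_iff)
  moreover have "(chi m :: ('a, 'k) group_ring) \<noteq> 0"
    using m prime_specD(2)[OF P] by metis
  then have "embed (chi w) = Fract (chi (m + w)) (chi m :: ('a, 'k) group_ring)"
    by (simp add: eq_fract gr_single_mult add.commute)
  ultimately show ?thesis
    using m(3) unfolding local_ring_at_def by blast
qed

section \<open>Loci of regularity\<close>

lemma local_ring_in_toric_points:
  "\<sigma> \<in> \<Sigma> \<Longrightarrow> P \<in> prime_spec (coord_ring N \<sigma>) \<Longrightarrow> local_ring_at (coord_ring N \<sigma>) P \<in> toric_points N \<Sigma>"
  unfolding toric_points_def by blast

text \<open>The domain of definition of the rational function \<open>z\<close>, the largest set of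
  points over which \<open>z\<close> is a section.\<close>

definition regular_locus :: "'a::euclidean_space set \<Rightarrow> 'a set set \<Rightarrow>
    ('a, 'k::idom) group_ring fract \<Rightarrow> ('a, 'k) group_ring fract set set" where
  "regular_locus N \<Sigma> z = {R \<in> toric_points N \<Sigma>. z \<in> R}"

lemma openin_regular_locus: "openin (toric_topology N \<Sigma>) (regular_locus N \<Sigma> z)"
  unfolding openin_toric_topology toric_open_def
proof (intro conjI ballI)
  fix \<sigma> assume \<sigma>: "\<sigma> \<in> \<Sigma>"
  let ?A = "coord_ring N \<sigma> :: ('a, 'b) group_ring set"
  have "denominators ?A z \<subseteq> ?A"
    by (auto simp: denominators_def)
  moreover have "\<forall>P\<in>prime_spec ?A.
      local_ring_at ?A P \<in> regular_locus N \<Sigma> z \<longleftrightarrow> \<not> denominators ?A z \<subseteq> P"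
    using local_ring_in_toric_points[OF \<sigma>] local_ring_iff_denominators[of _ ?A z]
    unfolding regular_locus_def by blast
  ultimately show "\<exists>I\<subseteq>?A. \<forall>P\<in>prime_spec ?A.
      local_ring_at ?A P \<in> regular_locus N \<Sigma> z \<longleftrightarrow> \<not> I \<subseteq> P"
    by blast
qed (auto simp: regular_locus_def)

lemma sections_in_chart:
  fixes U :: "('a::euclidean_space, 'k::idom) group_ring fract set set"
  assumes "z \<in> sections U"
    and "\<And>P. P \<in> prime_spec (coord_ring N \<sigma>) \<Longrightarrow> local_ring_at (coord_ring N \<sigma>) P \<in> U"
  obtains a where "a \<in> coord_ring N \<sigma>" "z = embed a"
  using Inter_local_rings[OF subring_coord_ring] assms unfolding sections_def by blast

text \<open>The hypotheses on \<open>w\<close> make \<open>chi w\<close> regular on the whole chart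
  of \<open>\<sigma>\<close>. This chart thus lies in the locus, and a section over it is an element
  of the coordinate ring.\<close>

lemma sections_regular_locus_chi:
  fixes z :: "('a::euclidean_space, 'k::idom) group_ring fract"
  assumes "\<sigma> \<in> \<Sigma>" "w \<in> dual_lattice N" "w \<in> dual_cone \<sigma>"
    and "z \<in> sections (regular_locus N \<Sigma> (embed (chi w)))"
  obtains a where "a \<in> coord_ring N \<sigma>" "z = embed a"
proof (rule sections_in_chart[OF assms(4)])
  fix P :: "('a, 'k) group_ring set"
  assume P: "P \<in> prime_spec (coord_ring N \<sigma>)"
  then show "local_ring_at (coord_ring N \<sigma>) P \<in> regular_locus N \<Sigma> (embed (chi w))"
    using assms
    by (auto simp: regular_locus_def local_ring_in_toric_points embed_in_local_ring
        subring_coord_ring chi_in_coord_ring_iff)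
qed (use that in blast)

lemma mult_pullback_chi: "mult_pullback q (chi w) = chi (real q *\<^sub>R w)"
  by (simp add: mult_pullback_def)

lemma mult_pullback_in_coord_ring:
  "f \<in> coord_ring N \<sigma> \<Longrightarrow> mult_pullback q f \<in> coord_ring N \<sigma>"
  using exponents_push[of "\<lambda>u. real q *\<^sub>R u" f]
  by (force simp: coord_ring_def mult_pullback_def dual_cone_def intro!: dual_lattice_scale)

text \<open>Makes \<open>chi w\<close> itself a legitimate argument of the splitting over
  \<open>U\<close>. Regularity at an image point pulls back to regularity of
  \<open>chi (q w)\<close>, and saturation removes the factor \<open>q\<close>.\<close>

lemma chi_in_sections_vimage:
  fixes U :: "('a::euclidean_space, 'k::idom) group_ring fract set set"
  assumes q: "q > 0" and w: "w \<in> dual_lattice N" and U: "embed (chi w) \<in> sections U"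
  shows "embed (chi w) \<in> sections (mult_vimage q N \<Sigma> U)"
  unfolding sections_def
proof
  fix R assume "R \<in> mult_vimage q N \<Sigma> U"
  then obtain \<sigma> P where R: "R = local_ring_at (coord_ring N \<sigma>) P"
    and P: "P \<in> prime_spec (coord_ring N \<sigma>)"
    and F: "local_ring_at (coord_ring N \<sigma>) {f \<in> coord_ring N \<sigma>. mult_pullback q f \<in> P} \<in> U"
    unfolding mult_vimage_def by blast
  let ?A = "coord_ring N \<sigma> :: ('a, 'k) group_ring set"
  let ?Q = "{f \<in> ?A. mult_pullback q f \<in> P}"
  have "embed (chi w) \<in> local_ring_at ?A ?Q"
    using F U by (auto simp: sections_def)
  moreover have "0 \<in> ?Q"
    using prime_specD(1,2)[OF P] by (auto simp: mult_pullback_def)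
  ultimately obtain a b where ab: "a \<in> ?A" "b \<in> ?A" "b \<notin> ?Q" "b \<noteq> 0" "embed (chi w) = Fract a b"
    by (rule local_ring_atE)
  then have "mult_pullback q b \<noteq> 0" "mult_pullback q b \<notin> P"
    using q by (auto simp: mult_pullback_eq_0_iff)
  moreover have "chi w * b = a"
    using ab by (simp add: eq_fract)
  then have "chi (real q *\<^sub>R w) * mult_pullback q b = mult_pullback q a"
    using mult_pullback_mult[of q "chi w" b] by (simp add: mult_pullback_chi)
  ultimately have "embed (chi (real q *\<^sub>R w)) = Fract (mult_pullback q a) (mult_pullback q b)"
    by (simp add: eq_fract)
  then have "embed (chi (real q *\<^sub>R w)) \<in> local_ring_at ?A P"
    using ab mult_pullback_in_coord_ring[of _ N \<sigma> q] \<open>mult_pullback q b \<notin> P\<close>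
    unfolding local_ring_at_def by blast
  then show "embed (chi w) \<in> R"
    unfolding R by (rule chi_in_local_ring_saturated[OF P q w])
qed

section \<open>Monomials under a splitting\<close>

lemma zero_prime: "{0} \<in> prime_spec (coord_ring N \<sigma> :: ('a::euclidean_space, 'k::idom) group_ring set)"
proof -
  let ?A = "coord_ring N \<sigma> :: ('a, 'k) group_ring set"
  have "0 \<in> ?A" "1 \<in> ?A"
    using subring_coord_ring unfolding subring_set_def by blast+
  moreover have "1 \<notin> {0 :: ('a, 'k) group_ring}"
    by simp
  ultimately have "{0} \<subset> ?A"
    by (metis psubsetI empty_subsetI insert_subset)
  then show ?thesis
    by (simp add: prime_spec_def)
qed

lemma splittingD:
  assumes "splitting q N \<Sigma> \<pi>" "openin (toric_topology N \<Sigma>) U" "U \<noteq> {}"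
  shows "b \<in> sections (mult_vimage q N \<Sigma> U) \<Longrightarrow> \<pi> U b \<in> sections U"
    and "b \<in> sections (mult_vimage q N \<Sigma> U) \<Longrightarrow> c \<in> sections (mult_vimage q N \<Sigma> U) \<Longrightarrow>
      \<pi> U (b + c) = \<pi> U b + \<pi> U c"
    and "a \<in> sections U \<Longrightarrow> b \<in> sections (mult_vimage q N \<Sigma> U) \<Longrightarrow>
      \<pi> U (mult_pullback_fract q a * b) = a * \<pi> U b"
    and "a \<in> sections U \<Longrightarrow> \<pi> U (mult_pullback_fract q a) = a"
    and "openin (toric_topology N \<Sigma>) V \<Longrightarrow> V \<noteq> {} \<Longrightarrow> V \<subseteq> U \<Longrightarrow>
      b \<in> sections (mult_vimage q N \<Sigma> U) \<Longrightarrow> \<pi> V b = \<pi> U b"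
proof -
  note * = assms(1)[unfolded splitting_def, THEN spec, THEN mp, OF conjI[OF assms(2,3)]]
  note c1 = *[THEN conjunct1]
    and c2 = *[THEN conjunct2, THEN conjunct1]
    and c3 = *[THEN conjunct2, THEN conjunct2, THEN conjunct1]
    and c4 = *[THEN conjunct2, THEN conjunct2, THEN conjunct2, THEN conjunct1]
    and c5 = *[THEN conjunct2, THEN conjunct2, THEN conjunct2, THEN conjunct2]
  show "b \<in> sections (mult_vimage q N \<Sigma> U) \<Longrightarrow> \<pi> U b \<in> sections U"
    by (rule c1[rule_format])
  show "b \<in> sections (mult_vimage q N \<Sigma> U) \<Longrightarrow> c \<in> sections (mult_vimage q N \<Sigma> U) \<Longrightarrow>
      \<pi> U (b + c) = \<pi> U b + \<pi> U c"
    by (rule c2[rule_format])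
  show "a \<in> sections U \<Longrightarrow> b \<in> sections (mult_vimage q N \<Sigma> U) \<Longrightarrow>
      \<pi> U (mult_pullback_fract q a * b) = a * \<pi> U b"
    by (rule c3[rule_format])
  show "a \<in> sections U \<Longrightarrow> \<pi> U (mult_pullback_fract q a) = a"
    by (rule c4[rule_format])
  show "openin (toric_topology N \<Sigma>) V \<Longrightarrow> V \<noteq> {} \<Longrightarrow> V \<subseteq> U \<Longrightarrow>
      b \<in> sections (mult_vimage q N \<Sigma> U) \<Longrightarrow> \<pi> V b = \<pi> U b"
    by (rule c5[rule_format, OF conjI[OF _ conjI]])
qed

lemma mult_pullback_1 [simp]: "mult_pullback q 1 = 1"
  by (simp only: chi_0[symmetric] mult_pullback_chi scaleR_zero_right)

lemma mult_pullback_fract_chi: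
  "q > 0 \<Longrightarrow> mult_pullback_fract q (embed (chi m)) = embed (chi (real q *\<^sub>R m))"
  by (simp add: mult_pullback_fract_Fract mult_pullback_chi)

lemma mult_pullback_fract_1 [simp]: "q > 0 \<Longrightarrow> mult_pullback_fract q 1 = 1"
  by (simp add: One_fract_def mult_pullback_fract_Fract)

text \<open>The generic point is common to all these loci, so their intersections are nonempty, as
  the axioms in \<open>splitting\<close> require.\<close>

lemma generic_point_in_regular_locus:
  assumes "{0} \<in> \<Sigma>" "w \<in> dual_lattice N"
  shows "local_ring_at (coord_ring N {0}) {0} \<in>
    regular_locus N \<Sigma> (embed (chi w :: ('a::euclidean_space, 'k::idom) group_ring))"
  using assms
  by (auto simp: regular_locus_def local_ring_in_toric_points zero_prime embed_in_local_ring
      subring_coord_ring chi_in_coord_ring_iff)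

lemma regular_locus_sections: "z \<in> sections (regular_locus N \<Sigma> z)"
  by (auto simp: sections_def regular_locus_def)

text \<open>
  Shrinking to an open set where \<open>\<chi>\<^sup>w\<close>, \<open>\<chi>\<^sup>m\<close> and \<open>\<chi>\<^bsup>w + q m\<^esup>\<close> are all regular, linearity gives
  \<open>\<pi>(\<chi>\<^bsup>w + q m\<^esup>) = \<chi>\<^sup>m \<pi>(\<chi>\<^sup>w)\<close>, and the left-hand side is regular on the chart of \<open>\<tau>\<close>.
\<close>

lemma splitting_exponents:
  fixes f :: "('a::euclidean_space, 'k::idom) group_ring"
  assumes q: "q > 0" and \<Sigma>: "{0} \<in> \<Sigma>" "\<tau> \<in> \<Sigma>"
    and split: "splitting q N \<Sigma> \<pi>"
    and w: "w \<in> dual_lattice N" and m: "m \<in> dual_lattice N"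
    and wm: "w + real q *\<^sub>R m \<in> dual_cone \<tau>"
    and f: "\<pi> (regular_locus N \<Sigma> (embed (chi w))) (embed (chi w)) = embed f"
    and a: "a \<in> exponents f"
  shows "a + m \<in> dual_cone \<tau>"
proof -
  let ?x = "\<lambda>u. embed (chi u) :: ('a, 'k) group_ring fract"
  let ?L = "\<lambda>u. regular_locus N \<Sigma> (?x u)"
  let ?w' = "w + real q *\<^sub>R m"
  have w': "?w' \<in> dual_lattice N"
    using w m by (intro dual_lattice_add dual_lattice_scale) auto
  define V where "V = ?L w \<inter> ?L ?w' \<inter> ?L m"
  note generic = generic_point_in_regular_locus[OF \<Sigma>(1), where 'k = 'k]
  have V: "openin (toric_topology N \<Sigma>) V" "V \<noteq> {}"
  proof -
    show "openin (toric_topology N \<Sigma>) V"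
      unfolding V_def by (intro openin_Int openin_regular_locus)
    have "local_ring_at (coord_ring N {0}) {0} \<in> V"
      unfolding V_def by (intro IntI generic w w' m)
    then show "V \<noteq> {}"
      by (metis empty_iff)
  qed
  have L: "openin (toric_topology N \<Sigma>) (?L u)" for u
    by (rule openin_regular_locus)
  have L_ne: "?L u \<noteq> {}" if "u \<in> dual_lattice N" for u
    using generic[OF that] by (metis empty_iff)
  have reg: "?x u \<in> sections (mult_vimage q N \<Sigma> (?L u))" if "u \<in> dual_lattice N" for u
    by (rule chi_in_sections_vimage[OF q that regular_locus_sections])
  have xV: "?x w \<in> sections V" "?x m \<in> sections V"
    by (auto simp: V_def sections_def regular_locus_def)
  have wV: "?x w \<in> sections (mult_vimage q N \<Sigma> V)"
    by (rule chi_in_sections_vimage[OF q w xV(1)])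
  have "\<pi> V (?x ?w') = \<pi> (?L ?w') (?x ?w')"
    by (rule splittingD(5)[OF split L L_ne[OF w'] V _ reg[OF w']]) (auto simp: V_def)
  moreover have "\<pi> (?L ?w') (?x ?w') \<in> sections (?L ?w')"
    by (rule splittingD(1)[OF split L L_ne[OF w'] reg[OF w']])
  ultimately obtain g where g: "g \<in> coord_ring N \<tau>" "\<pi> V (?x ?w') = embed g"
    using sections_regular_locus_chi[OF \<Sigma>(2) w' wm] by metis
  have "?x ?w' = mult_pullback_fract q (?x m) * ?x w"
    using q by (simp add: mult_pullback_fract_chi gr_single_mult add.commute)
  then have "\<pi> V (?x ?w') = ?x m * \<pi> V (?x w)"
    using splittingD(3)[OF split V xV(2) wV] by simp
  also have "\<pi> V (?x w) = \<pi> (?L w) (?x w)"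
    by (rule splittingD(5)[OF split L L_ne[OF w] V _ reg[OF w]]) (auto simp: V_def)
  finally have "embed g = embed (chi m * f)"
    using g f by simp
  then have "g = chi m * f"
    by (simp add: eq_fract)
  \<comment> \<open>Multiplication by \<open>chi m\<close> translates exponents without
    cancellation, so the argument reaches every exponent of \<open>f\<close>.\<close>
  then have "m + a \<in> exponents g"
    using a by (simp add: exponents_chi_mult)
  then show ?thesis
    using g(1) by (auto simp: coord_ring_def add.commute)
qed

section \<open>Splittings compatible with the diagonal\<close>

abbreviation restrict_diagonal ::
    "('a::euclidean_space \<times> 'a, 'k::idom) group_ring \<Rightarrow> ('a, 'k) group_ring" where
  "restrict_diagonal \<equiv> push (\<lambda>(u, u'). u + u')"

lemma restrict_diagonal_mult:
  "restrict_diagonal (f * g) = restrict_diagonal f * restrict_diagonal g"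
  by (rule push_mult) auto

lemma restrict_diagonal_1 [simp]: "restrict_diagonal 1 = 1"
  unfolding chi_0[symmetric] push_single by (simp add: zero_prod_def)

lemma restrict_diagonal_coord_ring:
  assumes "f \<in> coord_ring (N \<times> N) (\<sigma> \<times> \<sigma>)"
  shows "restrict_diagonal f \<in> coord_ring N \<sigma>"
proof -
  have "u + u' \<in> dual_lattice N \<inter> dual_cone \<sigma>"
    if "(u, u') \<in> dual_lattice (N \<times> N) \<inter> dual_cone (\<sigma> \<times> \<sigma>)" for u u'
    using that by (force simp: dual_lattice_def dual_cone_def inner_add_left)
  then show ?thesis
    using assms exponents_push[of "\<lambda>(u, u'). u + u'" f] unfolding coord_ring_def by fast
qed

lemma prime_spec_preimage:
  assumes A: "subring_set A" and P: "P \<in> prime_spec B" and hB: "\<And>a. a \<in> A \<Longrightarrow> h a \<in> B"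
    and h: "h 0 = 0" "h 1 = 1" "\<And>a b. h (a + b) = h a + h b" "\<And>a b. h (a * b) = h a * h b"
  shows "{a \<in> A. h a \<in> P} \<in> prime_spec A"
  unfolding prime_spec_def
proof (intro CollectI conjI ballI impI)
  have "1 \<in> A - {a \<in> A. h a \<in> P}"
    using A one_notin_prime[OF P] h(2) by (auto simp: subring_set_def)
  then show "{a \<in> A. h a \<in> P} \<subset> A"
    by blast
next
  fix a b assume "a \<in> A" "b \<in> A" "a * b \<in> {a \<in> A. h a \<in> P}"
  then show "a \<in> {a \<in> A. h a \<in> P} \<or> b \<in> {a \<in> A. h a \<in> P}"
    using prime_specD(5)[OF P hB hB] by (auto simp: h)
qed (use A hB prime_specD[OF P] in \<open>auto simp: subring_set_def h\<close>)

lemma diagonal_prime: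
  assumes "P \<in> prime_spec (coord_ring N \<sigma>)"
  shows "{f \<in> coord_ring (N \<times> N) (\<sigma> \<times> \<sigma>). restrict_diagonal f \<in> P} \<in>
    prime_spec (coord_ring (N \<times> N) (\<sigma> \<times> \<sigma>))"
  by (rule prime_spec_preimage[OF subring_coord_ring assms])
     (auto simp: restrict_diagonal_mult push_add restrict_diagonal_coord_ring)

lemma product_fanI: "\<sigma> \<in> \<Sigma> \<Longrightarrow> \<tau> \<in> \<Sigma> \<Longrightarrow> \<sigma> \<times> \<tau> \<in> product_fan \<Sigma>"
  unfolding product_fan_def by blast

lemma zero_in_product_fan: "{0} \<in> \<Sigma> \<Longrightarrow> {0} \<in> product_fan \<Sigma>"
  using product_fanI[of "{0}" \<Sigma> "{0}"] by (simp add: zero_prod_def)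

text \<open>By additivity and \<open>\<pi> U 1 = 1\<close>, the image of \<open>z - 1\<close> is
  \<open>f - 1\<close>. Testing its membership in the ideal sheaf at the generic point of the
  diagonal is enough.\<close>

lemma diagonal_compatible_splitting:
  fixes N :: "'a::euclidean_space set"
    and \<pi> :: "('a \<times> 'a, 'k::idom) group_ring fract set set \<Rightarrow>
      ('a \<times> 'a, 'k) group_ring fract \<Rightarrow> ('a \<times> 'a, 'k) group_ring fract"
  assumes q: "q > 0" and \<Sigma>: "{0} \<in> \<Sigma>"
    and split: "compatible_splitting q (N \<times> N) (product_fan \<Sigma>) (diagonal_points N \<Sigma>) \<pi>"
    and u: "u \<in> dual_lattice N"
  defines "z \<equiv> embed (chi (u, - u))"
  obtains f where "f \<in> coord_ring (N \<times> N) {0}"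
    and "\<pi> (regular_locus (N \<times> N) (product_fan \<Sigma>) z) z = embed f" "restrict_diagonal f = 1"
proof -
  let ?N = "N \<times> N" and ?\<Sigma> = "product_fan \<Sigma>" and ?Z = "diagonal_points N \<Sigma>"
  define U where "U = regular_locus ?N ?\<Sigma> z"
  let ?W = "mult_vimage q ?N ?\<Sigma> U"
  have split': "splitting q ?N ?\<Sigma> \<pi>"
    using split by (simp add: compatible_splitting_def)
  have zero: "{0} \<in> ?\<Sigma>"
    using \<Sigma> by (rule zero_in_product_fan)
  have uu: "(u, - u) \<in> dual_lattice ?N"
    using u by (auto simp: dual_lattice_def)
  have U: "openin (toric_topology ?N ?\<Sigma>) U" "U \<noteq> {}"
    using generic_point_in_regular_locus[OF zero uu] openin_regular_locus
    unfolding U_def z_def by (blast, metis empty_iff)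
  have zU: "z \<in> sections U"
    unfolding U_def by (rule regular_locus_sections)
  have zW: "z \<in> sections ?W"
    using zU unfolding z_def by (rule chi_in_sections_vimage[OF q uu])
  have "1 \<in> R" if "R \<in> toric_points ?N ?\<Sigma>" for R :: "('a \<times> 'a, 'k) group_ring fract set"
    using that embed_in_local_ring[OF subring_coord_ring, of _ _ _ 1] subring_coord_ring
    unfolding toric_points_def subring_set_def One_fract_def by blast
  then have oneU: "1 \<in> sections U"
    by (auto simp: sections_def U_def regular_locus_def)
  have chi0: "embed (chi 0) = (1 :: ('a \<times> 'a, 'k) group_ring fract)"
    by (simp add: One_fract_def)
  have oneW: "1 \<in> sections ?W"
    using chi_in_sections_vimage[OF q, of 0 ?N U ?\<Sigma>] oneU unfolding chi0 by simp
  have pi1: "\<pi> U 1 = 1"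
    using splittingD(4)[OF split' U oneU] q by simp
  have diff: "z - 1 \<in> ideal_sections ?Z ?W"
    unfolding ideal_sections_def
  proof (intro CollectI conjI ballI)
    show "z - 1 \<in> sections ?W"
      unfolding sections_def
    proof
      fix R assume R: "R \<in> ?W"
      then obtain \<sigma> P where P: "R = local_ring_at (coord_ring ?N \<sigma>) P"
        "P \<in> prime_spec (coord_ring ?N \<sigma>)"
        unfolding mult_vimage_def by blast
      have "z \<in> R"
        using zW R by (simp add: sections_def)
      then obtain a b where ab: "a \<in> coord_ring ?N \<sigma>" "b \<in> coord_ring ?N \<sigma>" "b \<notin> P" "b \<noteq> 0"
        "z = Fract a b"
        unfolding P(1) by (rule local_ring_atE) (rule prime_specD(2)[OF P(2)])
      have "z - 1 = Fract (a - b) b"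
        using ab by (simp add: One_fract_def)
      then show "z - 1 \<in> R"
        unfolding P(1) local_ring_at_def using ab coord_ring_diff by blast
    qed
    fix R assume R: "R \<in> ?Z \<inter> ?W"
    then obtain \<sigma> P where P: "P \<in> prime_spec (coord_ring N \<sigma>)"
      and Req: "R = local_ring_at (coord_ring ?N (\<sigma> \<times> \<sigma>))
        {f \<in> coord_ring ?N (\<sigma> \<times> \<sigma>). restrict_diagonal f \<in> P}"
      unfolding diagonal_points_def by blast
    let ?A = "coord_ring ?N (\<sigma> \<times> \<sigma>) :: ('a \<times> 'a, 'k) group_ring set"
    let ?Q = "{f \<in> ?A. restrict_diagonal f \<in> P}"
    have Q: "?Q \<in> prime_spec ?A"
      by (rule diagonal_prime[OF P])
    have zR: "z \<in> R" "z - 1 \<in> R"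
      using zW \<open>z - 1 \<in> sections ?W\<close> R by (auto simp: sections_def)
    \<comment> \<open>With \<open>z = a / b\<close> and \<open>1 / (z - 1) = c / d\<close>, clearing
      denominators gives \<open>(a - b) * c = b * d\<close>. On the diagonal the left side vanishes,
      so \<open>b\<close> or \<open>d\<close> would lie in the prime.\<close>
    have "inverse (z - 1) \<notin> R" if "z - 1 \<noteq> 0"
    proof
      assume "inverse (z - 1) \<in> R"
      then obtain c d where cd: "c \<in> ?A" "d \<in> ?A" "d \<notin> ?Q" "d \<noteq> 0" "inverse (z - 1) = Fract c d"
        unfolding Req by (rule local_ring_atE) (rule prime_specD(2)[OF Q])
      obtain a b where ab: "a \<in> ?A" "b \<in> ?A" "b \<notin> ?Q" "b \<noteq> 0" "z = Fract a b"
        using zR(1) unfolding Req by (rule local_ring_atE) (rule prime_specD(2)[OF Q])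
      have "chi (u, - u) * b = a"
        using ab by (simp add: z_def eq_fract)
      then have "restrict_diagonal (chi (u, - u)) * restrict_diagonal b = restrict_diagonal a"
        using restrict_diagonal_mult by metis
      then have ab0: "restrict_diagonal (a - b) = 0"
        by (simp add: push_diff)
      have "z - 1 = Fract (a - b) b"
        using ab by (simp add: One_fract_def)
      then have "Fract (a - b) b * Fract c d = 1"
        using that cd(5) by (metis right_inverse)
      then have "(a - b) * c = b * d"
        using ab(4) cd(4) by (simp add: One_fract_def eq_fract)
      then have "restrict_diagonal b * restrict_diagonal d = 0"
        using ab0 by (metis restrict_diagonal_mult mult_zero_left)
      then have "restrict_diagonal b \<in> P \<or> restrict_diagonal d \<in> P"
        using prime_specD(2)[OF P]
        by (intro prime_specD(5)[OF P] restrict_diagonal_coord_ring ab cd) auto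
      then show False
        using ab cd by blast
    qed
    then show "z - 1 \<in> max_ideal R"
      using zR by (auto simp: max_ideal_def)
  qed
  then have diffW: "z - 1 \<in> sections ?W"
    by (simp add: ideal_sections_def)
  have "\<pi> U z \<in> sections U"
    by (rule splittingD(1)[OF split' U zW])
  then obtain f where f: "f \<in> coord_ring ?N {0}" "\<pi> U z = embed f"
    using sections_regular_locus_chi[OF zero uu] unfolding U_def z_def by auto
  have "\<pi> U z = \<pi> U (z - 1) + \<pi> U 1"
    using splittingD(2)[OF split' U diffW oneW] by simp
  then have "\<pi> U (z - 1) = embed f - 1"
    using f(2) pi1 by (simp only: eq_diff_eq)
  then have "\<pi> U (z - 1) = embed (f - 1)"
    by (simp add: One_fract_def)
  moreover have "\<pi> U (z - 1) \<in> ideal_sections ?Z U"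
    using split U diff unfolding compatible_splitting_def by blast
  ultimately have f1: "embed (f - 1) \<in> ideal_sections ?Z U"
    by simp
  let ?A = "coord_ring ?N ({0} \<times> {0}) :: ('a \<times> 'a, 'k) group_ring set"
  \<comment> \<open>The kernel of restriction in the torus chart, which is the generic point of the
    diagonal.\<close>
  let ?Q = "{g \<in> ?A. restrict_diagonal g \<in> {0}}"
  have Q: "?Q \<in> prime_spec ?A"
    by (rule diagonal_prime[OF zero_prime])
  have A0: "?A = coord_ring ?N {0}"
    by (simp add: zero_prod_def)
  have "local_ring_at ?A ?Q \<in> ?Z"
    unfolding diagonal_points_def using \<Sigma> zero_prime by blast
  moreover have "local_ring_at ?A ?Q \<in> toric_points ?N ?\<Sigma>"
    by (rule local_ring_in_toric_points[OF product_fanI[OF \<Sigma> \<Sigma>] Q])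
  moreover have "chi (u, - u) \<in> ?A"
    unfolding A0 chi_in_coord_ring_iff using uu by simp
  then have "z \<in> local_ring_at ?A ?Q"
    unfolding z_def by (rule embed_in_local_ring[OF subring_coord_ring Q])
  ultimately have max: "embed (f - 1) \<in> max_ideal (local_ring_at ?A ?Q)"
    using f1 unfolding ideal_sections_def U_def regular_locus_def by blast
  \<comment> \<open>Otherwise \<open>f - 1\<close> would lie outside \<open>?Q\<close> and be a unit
    of the local ring there.\<close>
  have "restrict_diagonal (f - 1) = 0"
  proof (rule ccontr)
    assume ne: "restrict_diagonal (f - 1) \<noteq> 0"
    then have "f - 1 \<noteq> 0"
      by auto
    have "1 \<in> ?A"
      using subring_coord_ring unfolding subring_set_def by blast
    moreover from this have "f - 1 \<in> ?A"
      using f(1) unfolding A0[symmetric] by (intro coord_ring_diff)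
    then have "f - 1 \<in> ?A - ?Q"
      using ne by blast
    ultimately have "Fract 1 (f - 1) \<in> local_ring_at ?A ?Q"
      unfolding local_ring_at_def by blast
    then show False
      using max \<open>f - 1 \<noteq> 0\<close> by (auto simp: max_ideal_def Zero_fract_def eq_fract)
  qed
  then have "restrict_diagonal f = 1"
    by (simp add: push_diff)
  then show ?thesis
    using f that by (simp add: U_def)
qed

text \<open>After division by \<open>q\<close>, the point \<open>w - u / q\<close> lies in the open
  polytope of the known characterization and represents the class of \<open>- u / q\<close>. This is
  the necessity half of that characterization.\<close>

lemma diagonally_split_imp_representative:
  fixes N :: "'a::euclidean_space set"
  assumes N: "is_lattice N" and fan: "fan N \<Sigma>" and q: "q > 0"
    and split: "diagonally_split TYPE('k::field) q N \<Sigma>" and u: "u \<in> dual_lattice N"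
  obtains w where "w \<in> dual_lattice N"
    "\<And>v. v \<in> ray_generators N \<Sigma> \<Longrightarrow> \<bar>(real q *\<^sub>R w - u) \<bullet> v\<bar> < real q"
proof -
  let ?N = "N \<times> N" and ?\<Sigma> = "product_fan \<Sigma>"
  obtain \<pi> :: "('a \<times> 'a, 'k) group_ring fract set set \<Rightarrow>
      ('a \<times> 'a, 'k) group_ring fract \<Rightarrow> ('a \<times> 'a, 'k) group_ring fract"
    where \<pi>: "compatible_splitting q ?N ?\<Sigma> (diagonal_points N \<Sigma>) \<pi>"
    using split by (auto simp: diagonally_split_def)
  then have \<pi>': "splitting q ?N ?\<Sigma> \<pi>"
    by (simp add: compatible_splitting_def)
  have zero: "{0} \<in> \<Sigma>"
    using fan by (rule zero_cone_in_fan)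
  then have zero': "{0} \<in> ?\<Sigma>"
    by (rule zero_in_product_fan)
  have pair: "(x, y) \<in> dual_lattice ?N \<longleftrightarrow> x \<in> dual_lattice N \<and> y \<in> dual_lattice N" for x y
    using zero_in_lattice[OF N] by (force simp: dual_lattice_def)
  obtain f where f: "f \<in> coord_ring ?N {0}" "restrict_diagonal f = 1"
    "\<pi> (regular_locus ?N ?\<Sigma> (embed (chi (u, - u)))) (embed (chi (u, - u))) = embed f"
    using diagonal_compatible_splitting[OF q zero \<pi> u] by metis
  have "0 \<in> exponents (restrict_diagonal f)"
    unfolding f(2) by (simp flip: chi_0)
  then obtain p where p: "p \<in> exponents f" "0 = (\<lambda>(u, u'). u + u') p"
    using exponents_push by blast
  then have "p = (fst p, - fst p)"
    by (cases p) (simp add: eq_neg_iff_add_eq_0 add.commute)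
  then obtain w where w: "(w, - w) \<in> exponents f"
    using p(1) by metis
  then have wM: "w \<in> dual_lattice N"
    using f(1) by (auto simp: coord_ring_def pair)
  have uu: "(u, - u) \<in> dual_lattice ?N"
    using u by (simp add: pair dual_lattice_minus)
  note exps = splitting_exponents[OF q zero' _ \<pi>' uu _ _ f(3) w]
  have "\<bar>(real q *\<^sub>R w - u) \<bullet> v\<bar> < real q" if v: "v \<in> ray_generators N \<Sigma>" for v
  proof -
    let ?\<rho> = "{t *\<^sub>R v | t. t \<ge> 0}"
    have \<rho>: "?\<rho> \<in> \<Sigma>" "primitive_vector N v"
      using v by (auto simp: ray_generators_def)
    obtain m where m: "m \<in> dual_lattice N" "m \<bullet> v = 1"
      using primitive_pairing_one[OF N \<rho>(2)] by blast
    have v\<rho>: "v \<in> ?\<rho>"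
      by (auto intro: exI[of _ 1])
    define x where "x = u \<bullet> v / real q"
    have ux: "u \<bullet> v = real q * x"
      using q by (simp add: x_def)
    \<comment> \<open>The multiple of \<open>m\<close> that pairs with \<open>v\<close> to minus the
      floor of \<open>x\<close>: just enough for \<open>u + q k\<close> to pair nonnegatively with
      \<open>v\<close>. Likewise \<open>l\<close> pairs to the ceiling of \<open>x\<close> and
      serves \<open>- u\<close>.\<close>
    define k where "k = - of_int \<lfloor>x\<rfloor> *\<^sub>R m"
    define l where "l = - of_int \<lfloor>- x\<rfloor> *\<^sub>R m"
    have kl: "k \<in> dual_lattice N" "l \<in> dual_lattice N"
      using m(1) by (auto simp: k_def l_def intro!: dual_lattice_minus dual_lattice_scale)
    have k: "k \<bullet> v = - of_int \<lfloor>x\<rfloor>" and l: "l \<bullet> v = - of_int \<lfloor>- x\<rfloor>"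
      by (simp_all add: k_def l_def m)
    have "(w, - w) + (k, 0) \<in> dual_cone (?\<rho> \<times> {0})"
    proof (rule exps)
      show "?\<rho> \<times> {0} \<in> ?\<Sigma>"
        using \<rho>(1) zero by (rule product_fanI)
      show "(k, 0) \<in> dual_lattice ?N"
        using kl by (simp add: pair)
      have "(u + real q *\<^sub>R k) \<bullet> v = real q * (x - of_int \<lfloor>x\<rfloor>)"
        by (simp add: inner_add_left ux k right_diff_distrib)
      also have "\<dots> \<ge> 0"
        by simp
      finally show "(u, - u) + real q *\<^sub>R (k, 0) \<in> dual_cone (?\<rho> \<times> {0})"
        by (auto simp: dual_cone_def)
    qed
    \<comment> \<open>So \<open>w \<bullet> v\<close> is at least the floor of \<open>x\<close>. The
      strict inequality comes from the floor exceeding \<open>x - 1\<close>.\<close>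
    then have "(w + k) \<bullet> v \<ge> 0"
      using v\<rho> unfolding dual_cone_def by force
    then have 1: "w \<bullet> v > x - 1"
      unfolding inner_add_left k by linarith
    have "(w, - w) + (0, l) \<in> dual_cone ({0} \<times> ?\<rho>)"
    proof (rule exps)
      show "{0} \<times> ?\<rho> \<in> ?\<Sigma>"
        using zero \<rho>(1) by (rule product_fanI)
      show "(0, l) \<in> dual_lattice ?N"
        using kl by (simp add: pair)
      have "(- u + real q *\<^sub>R l) \<bullet> v = real q * (- x - of_int \<lfloor>- x\<rfloor>)"
        by (simp add: inner_diff_left ux l right_diff_distrib)
      also have "\<dots> \<ge> 0"
        using of_int_floor_le[of "- x"] by (intro mult_nonneg_nonneg) auto
      finally show "(u, - u) + real q *\<^sub>R (0, l) \<in> dual_cone ({0} \<times> ?\<rho>)"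
        by (auto simp: dual_cone_def)
    qed
    then have "(- w + l) \<bullet> v \<ge> 0"
      using v\<rho> unfolding dual_cone_def by force
    then have 2: "w \<bullet> v < x + 1"
      unfolding inner_add_left inner_minus_left l by linarith
    have "\<bar>(real q *\<^sub>R w - u) \<bullet> v\<bar> = real q * \<bar>w \<bullet> v - x\<bar>"
      by (simp add: inner_diff_left ux abs_mult flip: right_diff_distrib)
    also have "\<dots> < real q * 1"
      using 1 2 q by (intro mult_strict_left_mono) auto
    finally show ?thesis
      by simp
  qed
  then show ?thesis
    using wM that by blast
qed

section \<open>Unimodularity\<close>

lemma maximal_independent_spans:
  assumes "span R = UNIV" "B \<subseteq> R" "independent B"
    and max: "\<And>C. B \<subseteq> C \<Longrightarrow> C \<subseteq> R \<Longrightarrow> independent C \<Longrightarrow> C = B"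
  shows "span B = UNIV"
proof -
  have "v \<in> span B" if "v \<in> R" for v
  proof (rule ccontr)
    assume v: "v \<notin> span B"
    then have "insert v B = B"
      using assms(2,3) that by (intro max) (auto simp: independent_insert)
    then show False
      using v by (auto intro: span_base)
  qed
  then have "span R \<subseteq> span B"
    by (simp add: span_minimal subsetI)
  then show ?thesis
    using assms(1) by blast
qed

text \<open>
  Recording the parities of the pairings with \<open>B\<close> embeds \<open>M / 2 M\<close> into the subsets of \<open>B\<close>: an
  element of even pairings has a representative that pairs to zero with all of \<open>B\<close>. Both sides have
  \<open>2\<^sup>n\<close> elements, so every parity pattern occurs. The patterns with a single odd entry yield, up
  to sign, the dual basis of \<open>B\<close>.
\<close>

lemma unimodular_if_small_representatives:
  assumes N: "is_lattice N" and R: "R \<subseteq> N" "span R = UNIV"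
    and rep: "\<And>u. u \<in> dual_lattice N \<Longrightarrow>
      \<exists>w\<in>dual_lattice N. \<forall>v\<in>R. \<bar>(2 *\<^sub>R w - u) \<bullet> v\<bar> < 2"
  shows "unimodular N R"
  unfolding unimodular_def
proof (intro allI impI, elim conjE)
  let ?M = "dual_lattice N"
  fix B assume B: "B \<subseteq> R" "independent B"
    and "\<forall>C. B \<subseteq> C \<and> C \<subseteq> R \<and> independent C \<longrightarrow> C = B"
  then have span: "span B = UNIV"
    by (intro maximal_independent_spans[OF R(2)]) blast+
  have fin: "finite B"
    using B(2) by (rule independent_imp_finite)
  have cardB: "card B = DIM('a)"
    using B(2) span by (metis dim_UNIV dim_eq_card_independent dim_span)
  have BN: "B \<subseteq> N"
    using B R by blast
  have pairing: "u \<bullet> b = of_int \<lfloor>u \<bullet> b\<rfloor>" if "u \<in> ?M" "b \<in> B" for u b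
    using dual_latticeD[OF that(1), of b] that(2) BN by auto
  \<comment> \<open>Subtracting \<open>2 w\<close> keeps the parity of each pairing, and an integer
    of absolute value below 2 is 0 if even and 1 or -1 if odd.\<close>
  have small: "\<exists>w\<in>?M. \<forall>b\<in>B. \<bar>(u - 2 *\<^sub>R w) \<bullet> b\<bar> = (if odd \<lfloor>u \<bullet> b\<rfloor> then 1 else 0)"
    if u: "u \<in> ?M" for u
  proof -
    obtain w where w: "w \<in> ?M" "\<And>v. v \<in> R \<Longrightarrow> \<bar>(2 *\<^sub>R w - u) \<bullet> v\<bar> < 2"
      using rep[OF u] by blast
    have "\<bar>(u - 2 *\<^sub>R w) \<bullet> b\<bar> = (if odd \<lfloor>u \<bullet> b\<rfloor> then 1 else 0)" if b: "b \<in> B" for b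
    proof -
      let ?k = "\<lfloor>u \<bullet> b\<rfloor> - 2 * \<lfloor>w \<bullet> b\<rfloor>"
      have eq: "(u - 2 *\<^sub>R w) \<bullet> b = of_int ?k"
        using pairing[OF u b] pairing[OF w(1) b] by (simp add: inner_diff_left)
      have "\<bar>(u - 2 *\<^sub>R w) \<bullet> b\<bar> < 2"
        using w(2)[of b] b B(1) by (auto simp: inner_diff_left)
      then have "\<bar>?k\<bar> < 2"
        unfolding eq by linarith
      then have "\<bar>?k\<bar> = (if odd \<lfloor>u \<bullet> b\<rfloor> then 1 else 0)"
        by presburger
      then show ?thesis
        unfolding eq by (simp only: of_int_abs[symmetric]) simp
    qed
    then show ?thesis
      using w(1) by blast
  qed
  obtain E d where E: "finite E" "card E = DIM('a)" "E \<subseteq> N"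
    and d: "\<And>e. e \<in> E \<Longrightarrow> d e \<in> ?M"
    "\<And>e c. e \<in> E \<Longrightarrow> c \<in> E \<Longrightarrow> d e \<bullet> c = (if e = c then 1 else 0)"
    by (rule lattice_coordinates[OF N]) blast
  \<comment> \<open>The subset sums of a basis of the dual lattice represent its classes modulo
    2.\<close>
  define c where "c S = sum d S" for S
  have cM: "c S \<in> ?M" if "S \<subseteq> E" for S
    using that d(1) by (auto simp: c_def intro!: dual_lattice_sum)
  have ce: "c S \<bullet> e = (if e \<in> S then 1 else 0)" if "S \<subseteq> E" "e \<in> E" for S e
  proof -
    have "c S \<bullet> e = (\<Sum>x\<in>S. if x = e then 1 else 0)"
      unfolding c_def inner_sum_left using that d(2) by (intro sum.cong) auto
    then show ?thesis
      using finite_subset[OF that(1) E(1)] by simp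
  qed
  define parity where "parity S = {b \<in> B. odd \<lfloor>c S \<bullet> b\<rfloor>}" for S
  have "inj_on parity (Pow E)"
  proof (rule inj_onI)
    fix S T assume ST: "S \<in> Pow E" "T \<in> Pow E" and eq: "parity S = parity T"
    then have M: "c S \<in> ?M" "c T \<in> ?M" "c S - c T \<in> ?M"
      using cM by (auto intro: dual_lattice_diff)
    obtain w where w: "w \<in> ?M"
      "\<And>b. b \<in> B \<Longrightarrow> \<bar>(c S - c T - 2 *\<^sub>R w) \<bullet> b\<bar> = (if odd \<lfloor>(c S - c T) \<bullet> b\<rfloor> then 1 else 0)"
      using small[OF M(3)] by blast
    \<comment> \<open>Equal parity patterns make the difference even on \<open>B\<close>, so its
      small representative vanishes on \<open>B\<close>, which spans. Hence \<open>c S - c T\<close>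
      is twice a dual lattice vector, and pairing with \<open>E\<close> separates \<open>S\<close>
      from \<open>T\<close> modulo 2.\<close>
    have "(c S - c T - 2 *\<^sub>R w) \<bullet> b = 0" if b: "b \<in> B" for b
    proof -
      have "(c S - c T) \<bullet> b = of_int (\<lfloor>c S \<bullet> b\<rfloor> - \<lfloor>c T \<bullet> b\<rfloor>)"
        using pairing[OF M(1) b] pairing[OF M(2) b] by (simp add: inner_diff_left)
      then have "\<lfloor>(c S - c T) \<bullet> b\<rfloor> = \<lfloor>c S \<bullet> b\<rfloor> - \<lfloor>c T \<bullet> b\<rfloor>"
        by (simp only: floor_of_int)
      moreover have "odd \<lfloor>c S \<bullet> b\<rfloor> \<longleftrightarrow> odd \<lfloor>c T \<bullet> b\<rfloor>"
        using eq b unfolding parity_def by blast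
      ultimately show ?thesis
        using w(2)[OF b] by simp
    qed
    then have "B \<subseteq> {x. (c S - c T - 2 *\<^sub>R w) \<bullet> x = 0}"
      by blast
    then have "span B \<subseteq> {x. (c S - c T - 2 *\<^sub>R w) \<bullet> x = 0}"
      by (intro span_minimal subspace_hyperplane)
    then have "(c S - c T - 2 *\<^sub>R w) \<bullet> (c S - c T - 2 *\<^sub>R w) = 0"
      using span by blast
    then have cw: "c S - c T = 2 *\<^sub>R w"
      by simp
    have "e \<in> S \<longleftrightarrow> e \<in> T" if e: "e \<in> E" for e
    proof -
      obtain k where k: "w \<bullet> e = of_int k"
        using dual_latticeD[OF w(1), of e] e E(3) by (auto elim: Ints_cases)
      have "(if e \<in> S then 1 else 0) - (if e \<in> T then 1 else 0) = 2 * real_of_int k"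
        using arg_cong[OF cw, of "\<lambda>x. x \<bullet> e"] ce[of S e] ce[of T e] ST e k
        by (simp add: inner_diff_left)
      then have "(if e \<in> S then 1 else 0) - (if e \<in> T then 1 else 0) = 2 * k"
        by (simp split: if_splits)
      then show ?thesis
        by (auto split: if_splits) presburger+
    qed
    then show "S = T"
      using ST by blast
  qed
  then have "card (parity ` Pow E) = card (Pow B)"
    by (simp add: card_image card_Pow fin E cardB)
  then have surj: "parity ` Pow E = Pow B"
    using fin by (intro card_subset_eq) (auto simp: parity_def)
  obtain d' where d': "\<And>x. x = (\<Sum>b\<in>B. (d' b \<bullet> x) *\<^sub>R b)"
    using dual_basis_exists[OF B(2) span] by metis
  have int: "d' b \<bullet> x \<in> \<int>" if b: "b \<in> B" and x: "x \<in> N" for b x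
  proof -
    obtain S where S: "S \<subseteq> E" "parity S = {b}"
      using surj b by (metis (no_types, lifting) Pow_iff empty_subsetI imageE insert_subset)
    obtain w where w: "w \<in> ?M"
      "\<And>b'. b' \<in> B \<Longrightarrow> \<bar>(c S - 2 *\<^sub>R w) \<bullet> b'\<bar> = (if odd \<lfloor>c S \<bullet> b'\<rfloor> then 1 else 0)"
      using small[OF cM[OF S(1)]] by blast
    \<comment> \<open>This vector pairs to 1 or -1 with \<open>b\<close> and to 0 with the rest of
      \<open>B\<close>, so up to sign it is the dual basis vector of \<open>b\<close>, and it is
      integral on \<open>N\<close>.\<close>
    define a where "a = c S - 2 *\<^sub>R w"
    have a: "a \<in> ?M"
      unfolding a_def using cM[OF S(1)] w(1) by (intro dual_lattice_diff dual_lattice_scale) auto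
    have ab: "\<bar>a \<bullet> b'\<bar> = (if b' = b then 1 else 0)" if "b' \<in> B" for b'
    proof -
      have "odd \<lfloor>c S \<bullet> b'\<rfloor> \<longleftrightarrow> b' = b"
        using S(2) that unfolding parity_def by blast
      then show ?thesis
        using w(2)[OF that] by (simp add: a_def)
    qed
    have "a \<bullet> x = (\<Sum>b'\<in>B. (d' b' \<bullet> x) * (a \<bullet> b'))"
      by (subst d'[of x]) (simp add: inner_sum_right)
    also have "\<dots> = (\<Sum>b'\<in>B. if b' = b then (d' b \<bullet> x) * (a \<bullet> b) else 0)"
    proof (intro sum.cong refl)
      fix b' assume "b' \<in> B"
      from ab[OF this]
      show "(d' b' \<bullet> x) * (a \<bullet> b') = (if b' = b then (d' b \<bullet> x) * (a \<bullet> b) else 0)"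
        by (cases "b' = b") auto
    qed
    also have "\<dots> = (d' b \<bullet> x) * (a \<bullet> b)"
      using fin b by simp
    finally have "d' b \<bullet> x = a \<bullet> x \<or> d' b \<bullet> x = - (a \<bullet> x)"
      using ab[OF b] by (auto simp: abs_if split: if_splits)
    then show ?thesis
      using dual_latticeD[OF a x] by auto
  qed
  show "int_span B = N"
    unfolding int_span_finite[OF fin]
  proof (intro equalityI subsetI)
    fix x assume "x \<in> {\<Sum>b\<in>B. of_int (c b) *\<^sub>R b | c. True}"
    then obtain c where x: "x = (\<Sum>b\<in>B. of_int (c b) *\<^sub>R b)"
      by blast
    have "u \<bullet> x \<in> \<int>" if "u \<in> ?M" for u
      unfolding x inner_sum_right using dual_latticeD[OF that] BN by (intro Ints_sum) auto
    then show "x \<in> N"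
      by (rule lattice_bidual[OF N])
  next
    fix x assume x: "x \<in> N"
    have "x = (\<Sum>b\<in>B. of_int \<lfloor>d' b \<bullet> x\<rfloor> *\<^sub>R b)"
      by (subst d') (use int[OF _ x] in \<open>auto intro!: sum.cong\<close>)
    then show "x \<in> {\<Sum>b\<in>B. of_int (c b) *\<^sub>R b | c. True}"
      by (intro CollectI exI[of _ "\<lambda>b. \<lfloor>d' b \<bullet> x\<rfloor>"]) simp
  qed
qed

theorem theorem1p3:
  fixes N :: "'a::euclidean_space set" and \<Sigma> :: "'a set set"
  assumes "is_lattice N"
    and "complete_fan N \<Sigma>"
    and "\<not> unimodular N (ray_generators N \<Sigma>)"
  shows "\<not> diagonally_split TYPE('k::field) 2 N \<Sigma>"
proof
  assume split: "diagonally_split TYPE('k) 2 N \<Sigma>"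
  have "unimodular N (ray_generators N \<Sigma>)"
  proof (rule unimodular_if_small_representatives)
    show "ray_generators N \<Sigma> \<subseteq> N"
      by (auto simp: ray_generators_def primitive_vector_def)
    show "span (ray_generators N \<Sigma>) = UNIV"
      using assms(1,2) by (rule span_ray_generators)
    have fan: "fan N \<Sigma>"
      using assms(2) by (simp add: complete_fan_def)
    fix u assume u: "u \<in> dual_lattice N"
    obtain w where "w \<in> dual_lattice N"
      "\<And>v. v \<in> ray_generators N \<Sigma> \<Longrightarrow> \<bar>(real 2 *\<^sub>R w - u) \<bullet> v\<bar> < real 2"
      using diagonally_split_imp_representative[OF assms(1) fan _ split u] zero_less_numeral by blast
    then show "\<exists>w\<in>dual_lattice N. \<forall>v\<in>ray_generators N \<Sigma>. \<bar>(2 *\<^sub>R w - u) \<bullet> v\<bar> < 2"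
      by (intro bexI[of _ w]) simp_all
  qed (fact assms(1))
  then show False
    using assms(3) by contradiction
qed

end
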